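(* Let $d_1,\dots,d_p\ge 0$ be integers with $d_p>0$ and $\mathfrak l=\sum_i d_i\le\min(k,m)$, and let $n_{\min}=\sum_{i=1}^p i\,d_i$. Consider the regression model $y_t=\sum_{i=1}^p\Phi_ix_{t-i}+\epsilon_t$, where the minimal state-space realization of $\sum_{i=1}^p\Phi_iL^i$ is represented by the nilpotent Jordan matrix $F$ with blocks $K(p,d_p),\dots,K(1,d_1)$; that is, $\Phi_i=HF^{i-1}G$, where $H$ is a $k\times n_{\min}$ matrix and $G$ is an $n_{\min}\times m$ matrix such that $G_{:,0}$ has full row rank. Let $Y$, $L^i X$ and $X_{LAG}$ be the data matrices of the context, such that the vertical stack of $Y$ and $X_{LAG}$ has full row rank. Then: (1) $\kappa(G)$ has full row rank if $G_{:,0}$ has full row rank. (2) For fixed $G$ (with $G_{:,0}$ of full row rank), the optimal $H$ minimizing the determinant of the residual covariance matrix $(Y-\sum_iHF^{i-1}G\,L^iX)(Y-\sum_iHF^{i-1}G\,L^iX)'$ is $$H(G)=YX_{LAG}'\kappa(G)'\big(\kappa(G)X_{LAG}X_{LAG}'\kappa(G)'\big)^{-1},$$ and the resulting residual determinant is $$\det\Big(YY'-YX_{LAG}'\kappa(G)'\big(\kappa(G)X_{LAG}X_{LAG}'\kappa(G)'\big)^{-1}\kappa(G)X_{LAG}Y'\Big).$$ (3) Minimizing this residual determinant over $G$ is equivalent to minimizing $$\mathcal R(G)=\frac{\det(\kappa(G)A\kappa(G)')}{\det(\kappa(G)B\kappa(G)')},\qquad A=X_{LAG}X_{LAG}'-X_{LAG}Y'(YY')^{-1}YX_{LAG}',\quad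 B=X_{LAG}X_{LAG}'.$$ (4) The log-gradient of $\mathcal R$, i.e. the directional derivative of $\log\mathcal R$ at $G$ in the direction of an $n_{\min}\times m$ matrix $\eta$, is $$2\,\mathrm{Tr}\big((\kappa(G)A\kappa(G)')^{-1}\kappa(G)A\kappa(\eta)'\big)-2\,\mathrm{Tr}\big((\kappa(G)B\kappa(G)')^{-1}\kappa(G)B\kappa(\eta)'\big).$$ (5) For $U\in\{A,B\}$ and $n_{\min}\times m$ matrices $\psi,\eta$, define $$\mathcal H(U,G,\psi,\eta)=2\,\mathrm{Tr}\Big((\kappa(G)U\kappa(G)')^{-1}\big(\kappa(G)U\kappa(\psi)'+\kappa(\psi)U\kappa(G)'\big)-(\kappa(G)U\kappa(G)')^{-1}\kappa(\psi)U\kappa(\eta)'\Big).$$ Then the Hessian of $\log\mathcal R$ at $G$ is $\mathcal H(A,G,\psi,\eta)-\mathcal H(B,G,\psi,\eta)$.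
   Context: All matrices are real and $'$ denotes transpose; $k,m,p$ are positive integers ($y_t$ has dimension $k$, $x_t$ has dimension $m$), and $L$ is the lag operator. $K(r,d)=J_r\otimes I_d$, with $J_r$ the $r\times r$ matrix with ones on the first superdiagonal and zeros elsewhere; $F=\mathrm{diag}(K(p,d_p),\dots,K(1,d_1))$ (blocks with $d_r=0$ are skipped). The rows of an $n_{\min}\times m$ matrix $G$ are partitioned into blocks $G_{r,j}$ of size $d_r\times m$, $1\le r\le p$, $0\le j\le r-1$, stacked from top to bottom with $r$ descending from $p$ to $1$ and, for each $r$, $j$ descending from $r-1$ to $0$. $G_{:,0}$ is the vertical stack of $G_{p,0},\dots,G_{1,0}$. $\kappa(G)$ is the $n_{\min}\times pm$ block matrix with row blocks indexed by $(r,l)$, $r$ in descending order from $p$ to $1$ and, for each $r$, $l$ ascending from $0$ to $r-1$, and column blocks (each of width $m$) indexed by $i=p,p-1,\dots,1$ from left to right, with $$\kappa(G)_{(r,l),i}=G_{r,r-l-i}\ \text{ if } i\le r-l,\qquad \kappa(G)_{(r,l),i}=0\ \text{ otherwise.}$$ $\kappa(\eta)$ and $\kappa(\psi)$ are defined by the same formula for any $n_{\min}\times m$ matrices. The data are $T+p$ samples, in a $k\times(T+p)$ matrix $Y_f$ and an $m\times(T+p)$ matrix $X_f$; $Y$ is the $k\times T$ submatrix of $Y_f$ omitting the first $p$ columns, and $L^iX$ ($1\le i\le p$) is the $m\times T$ submatrix of $X_f$ omitting the last $i$ and the first $p-i$ columns. $X_{LAG}$ is the $pm\times T$ vertical stack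 of $L^pX,L^{p-1}X,\dots,LX$.
   Formalization: In (5) the printed H(U,G,ψ,η) is not linear in η, so it cannot be a Hessian; with M=κ(G)Uκ(G)' it is corrected to 2Tr(M⁻¹κ(ψ)Uκ(η)' − M⁻¹(κ(G)Uκ(ψ)'+κ(ψ)Uκ(G)')M⁻¹κ(G)Uκ(η)'). *)

theory Defs
  imports
    "HOL-Analysis.Derivative"
    "Jordan_Normal_Form.DL_Rank"
    "Jordan_Normal_Form.Gauss_Jordan_Elimination"
begin

subsection \<open>Matrix notions\<close>

definition full_row_rank :: "real mat \<Rightarrow> bool" where
  "full_row_rank A \<longleftrightarrow> vec_space.rank (dim_row A) A = dim_row A"

text \<open>On a singular matrix \<open>minv\<close> is unspecified.\<close>

definition minv :: "real mat \<Rightarrow> real mat" where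
  "minv A = the (mat_inverse A)"

definition Tr :: "real mat \<Rightarrow> real" where
  "Tr A = (\<Sum>i<dim_row A. A $$ (i, i))"

definition kron :: "real mat \<Rightarrow> real mat \<Rightarrow> real mat" where
  "kron A B = mat (dim_row A * dim_row B) (dim_col A * dim_col B)
     (\<lambda>(i, j). A $$ (i div dim_row B, j div dim_col B) * B $$ (i mod dim_row B, j mod dim_col B))"

text \<open>Stacks of a list of blocks. The common number of columns (rows) is passed explicitly so that
  empty lists have the right shape.\<close>

definition vstack :: "nat \<Rightarrow> real mat list \<Rightarrow> real mat" where
  "vstack nc As = foldr (@\<^sub>r) As (0\<^sub>m 0 nc)"

definition hstack :: "nat \<Rightarrow> real mat list \<Rightarrow> real mat" where
  "hstack nr As = (vstack nr (map transpose_mat As))\<^sup>T"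

definition has_dir_deriv :: "(real mat \<Rightarrow> real) \<Rightarrow> real \<Rightarrow> real mat \<Rightarrow> real mat \<Rightarrow> bool" where
  "has_dir_deriv f D G \<eta> \<longleftrightarrow> ((\<lambda>s. f (G + s \<cdot>\<^sub>m \<eta>)) has_real_derivative D) (at 0)"

definition dir_deriv :: "(real mat \<Rightarrow> real) \<Rightarrow> real mat \<Rightarrow> real mat \<Rightarrow> real" where
  "dir_deriv f G \<eta> = deriv (\<lambda>s. f (G + s \<cdot>\<^sub>m \<eta>)) 0"


subsection \<open>The nilpotent Jordan structure\<close>

text \<open>The multiplicities are given by \<open>d :: nat \<Rightarrow> nat\<close>, of which only \<open>d 1, \<dots>, d p\<close> are
  used. The list \<open>[p, p - 1, \<dots>, 1]\<close> is \<open>rev [1..<Suc p]\<close>.\<close>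

definition n_min :: "nat \<Rightarrow> (nat \<Rightarrow> nat) \<Rightarrow> nat" where
  "n_min p d = (\<Sum>i=1..p. i * d i)"

definition J_mat :: "nat \<Rightarrow> real mat" where
  "J_mat r = mat r r (\<lambda>(i, j). if j = i + 1 then 1 else 0)"

definition K_mat :: "nat \<Rightarrow> nat \<Rightarrow> real mat" where
  "K_mat r e = kron (J_mat r) (1\<^sub>m e)"

definition F_mat :: "nat \<Rightarrow> (nat \<Rightarrow> nat) \<Rightarrow> real mat" where
  "F_mat p d = diag_block_mat (map (\<lambda>r. K_mat r (d r)) (rev [1..<Suc p]))"

definition Phi :: "nat \<Rightarrow> (nat \<Rightarrow> nat) \<Rightarrow> real mat \<Rightarrow> real mat \<Rightarrow> nat \<Rightarrow> real mat" where
  "Phi p d H G i = H * (F_mat p d ^\<^sub>m (i - 1)) * G"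

text \<open>\<open>G_block p d m G r j\<close> is $G_{r,j}$. Above the group of rows belonging to \<open>r\<close> lie the groups of
  \<open>q = p, \<dots>, r + 1\<close>, having \<open>q * d q\<close> rows each; within the group \<open>j\<close> descends from \<open>r - 1\<close> to \<open>0\<close>.\<close>

definition G_block :: "nat \<Rightarrow> (nat \<Rightarrow> nat) \<Rightarrow> nat \<Rightarrow> real mat \<Rightarrow> nat \<Rightarrow> nat \<Rightarrow> real mat" where
  "G_block p d m G r j =
     mat (d r) m (\<lambda>(a, c). G $$ ((\<Sum>q=Suc r..p. q * d q) + (r - 1 - j) * d r + a, c))"

definition G_zero :: "nat \<Rightarrow> (nat \<Rightarrow> nat) \<Rightarrow> nat \<Rightarrow> real mat \<Rightarrow> real mat" where
  "G_zero p d m G = vstack m (map (\<lambda>r. G_block p d m G r 0) (rev [1..<Suc p]))"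

definition kappa :: "nat \<Rightarrow> (nat \<Rightarrow> nat) \<Rightarrow> nat \<Rightarrow> real mat \<Rightarrow> real mat" where
  "kappa p d m G = vstack (p * m)
     [hstack (d r)
        [if i \<le> r - l then G_block p d m G r (r - l - i) else 0\<^sub>m (d r) m. i \<leftarrow> rev [1..<Suc p]].
      r \<leftarrow> rev [1..<Suc p], l \<leftarrow> [0..<r]]"


subsection \<open>Data matrices\<close>

definition drop_lead :: "nat \<Rightarrow> nat \<Rightarrow> nat \<Rightarrow> real mat \<Rightarrow> real mat" where
  "drop_lead k p T Yf = mat k T (\<lambda>(a, t). Yf $$ (a, t + p))"

definition lag :: "nat \<Rightarrow> nat \<Rightarrow> nat \<Rightarrow> real mat \<Rightarrow> nat \<Rightarrow> real mat" where
  "lag m p T Xf i = mat m T (\<lambda>(a, t). Xf $$ (a, t + (p - i)))"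

definition X_lag :: "nat \<Rightarrow> nat \<Rightarrow> nat \<Rightarrow> real mat \<Rightarrow> real mat" where
  "X_lag m p T Xf = vstack T (map (lag m p T Xf) (rev [1..<Suc p]))"


subsection \<open>The regression criteria\<close>

definition residual ::
  "nat \<Rightarrow> nat \<Rightarrow> nat \<Rightarrow> nat \<Rightarrow> (nat \<Rightarrow> nat) \<Rightarrow> real mat \<Rightarrow> real mat \<Rightarrow> real mat \<Rightarrow> real mat \<Rightarrow> real mat" where
  "residual k m p T d Yf Xf H G = drop_lead k p T Yf -
     mat k T (\<lambda>(a, t). \<Sum>i=1..p. (Phi p d H G i * lag m p T Xf i) $$ (a, t))"

definition residual_det ::
  "nat \<Rightarrow> nat \<Rightarrow> nat \<Rightarrow> nat \<Rightarrow> (nat \<Rightarrow> nat) \<Rightarrow> real mat \<Rightarrow> real mat \<Rightarrow> real mat \<Rightarrow> real mat \<Rightarrow> real" where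
  "residual_det k m p T d Yf Xf H G =
     det (residual k m p T d Yf Xf H G * (residual k m p T d Yf Xf H G)\<^sup>T)"

definition H_opt :: "nat \<Rightarrow> (nat \<Rightarrow> nat) \<Rightarrow> nat \<Rightarrow> real mat \<Rightarrow> real mat \<Rightarrow> real mat \<Rightarrow> real mat" where
  "H_opt p d m Y X G =
     Y * X\<^sup>T * (kappa p d m G)\<^sup>T * minv (kappa p d m G * X * X\<^sup>T * (kappa p d m G)\<^sup>T)"

definition profile_det :: "nat \<Rightarrow> (nat \<Rightarrow> nat) \<Rightarrow> nat \<Rightarrow> real mat \<Rightarrow> real mat \<Rightarrow> real mat \<Rightarrow> real" where
  "profile_det p d m Y X G = det (Y * Y\<^sup>T -
     Y * X\<^sup>T * (kappa p d m G)\<^sup>T * minv (kappa p d m G * X * X\<^sup>T * (kappa p d m G)\<^sup>T)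
       * kappa p d m G * X * Y\<^sup>T)"

definition R_ratio :: "nat \<Rightarrow> (nat \<Rightarrow> nat) \<Rightarrow> nat \<Rightarrow> real mat \<Rightarrow> real mat \<Rightarrow> real mat \<Rightarrow> real" where
  "R_ratio p d m A B G =
     det (kappa p d m G * A * (kappa p d m G)\<^sup>T) / det (kappa p d m G * B * (kappa p d m G)\<^sup>T)"

definition grad_term :: "nat \<Rightarrow> (nat \<Rightarrow> nat) \<Rightarrow> nat \<Rightarrow> real mat \<Rightarrow> real mat \<Rightarrow> real mat \<Rightarrow> real" where
  "grad_term p d m U G \<eta> =
     2 * Tr (minv (kappa p d m G * U * (kappa p d m G)\<^sup>T) * kappa p d m G * U * (kappa p d m \<eta>)\<^sup>T)"

text \<open>The second derivative of $\log\det(\kappa(G)U\kappa(G)')$ in the directions \<open>\<psi>\<close> and \<open>\<eta>\<close>. Writing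
  $M = \kappa(G)U\kappa(G)'$, the source prints
  $2\,\mathrm{Tr}(M^{-1}(\kappa(G)U\kappa(\psi)' + \kappa(\psi)U\kappa(G)') - M^{-1}\kappa(\psi)U\kappa(\eta)')$.
  This is not linear in \<open>\<eta>\<close>, so it cannot be a Hessian: the factor
  $M^{-1}\kappa(G)U\kappa(\eta)'$ of the first summand is missing and the overall sign is reversed.
  Both are corrected here.\<close>

definition hess_term ::
  "nat \<Rightarrow> (nat \<Rightarrow> nat) \<Rightarrow> nat \<Rightarrow> real mat \<Rightarrow> real mat \<Rightarrow> real mat \<Rightarrow> real mat \<Rightarrow> real" where
  "hess_term p d m U G \<psi> \<eta> =
     (let KG = kappa p d m G; K\<psi> = kappa p d m \<psi>; K\<eta> = kappa p d m \<eta>; Mi = minv (KG * U * KG\<^sup>T)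
      in 2 * Tr (Mi * K\<psi> * U * K\<eta>\<^sup>T - Mi * (KG * U * K\<psi>\<^sup>T + K\<psi> * U * KG\<^sup>T) * Mi * KG * U * K\<eta>\<^sup>T))"

end

theory Submission
  imports Defs
begin

text \<open>
  In terms of $F$, the block column $i$ of $\kappa(G)$ is $F^{i-1}G$. Hence $\kappa$ is linear, and the
  residual is $Y - HZ$ with $Z = \kappa(G)X$, so for fixed $G$ the problem is a least squares problem in
  $H$: with $E_0 = Y - H_0Z$ orthogonal to $Z$, the residual Gram matrix is $E_0E_0' + CC'$ with
  $C = (H_0 - H)Z$, and its determinant increases strictly along $E_0E_0' + tCC'$ unless $C = 0$, by
  Jacobi's formula. The two Schur complement expansions of the Gram determinant of the stack of $Y$ and
  $Z$ give $\det(YY')\det(\kappa A\kappa') = \det(\kappa B\kappa')\det(E_0E_0')$, which relates the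
  profile determinant to $\mathcal R$. Gradient and Hessian follow from Jacobi's formula and the
  derivative $-M^{-1}M'M^{-1}$ of the inverse.
\<close>

subsection \<open>Matrix arithmetic with dimension side conditions\<close>

text \<open>Up to the order of its block columns, \<open>kappa p d m G\<close> is the
  controllability matrix of the pair (F, G). Since F is nilpotent, the rank test for controllability
  concerns only the left kernel of F itself. That kernel sits on the bottom sub-block of every
  Jordan group, and the rows of G found there are exactly those collected in \<open>G_zero\<close>.
  This is why a condition on \<open>G_zero\<close> alone yields full row rank. Invertibility has a
  single source: a relation C Y + D X = 0 between the rows of the stacked data forces C and D to
  vanish. The rows of Z and of every residual Y - H Z inherit this, so their Gram matrices are
  positive definite; positivity of the determinant belonging to A then follows from the determinant
  identity. The obstacle in the derivatives is that \<open>minv\<close> is unspecified on singular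
  matrices and that the logarithm of a quotient is split only where both determinants are positive.
  The formulas are therefore used only near the point, and continuity of the determinant supplies
  the neighbourhood.\<close>

lemma mult_assoc_dim:
  fixes A :: "real mat"
  assumes "dim_col A = dim_row B" "dim_col B = dim_row C"
  shows "A * B * C = A * (B * C)"
  using assoc_mult_mat[of A "dim_row A" "dim_col A" B "dim_col B" C "dim_col C"] assms
  by (metis carrier_matI)

lemma transpose_mult_dim:
  fixes A :: "real mat"
  assumes "dim_col A = dim_row B"
  shows "(A * B)\<^sup>T = B\<^sup>T * A\<^sup>T"
  using transpose_mult[of A "dim_row A" "dim_col A" B "dim_col B"] assms by (metis carrier_matI)

lemma add_mult_dim:
  fixes A :: "real mat"
  assumes "dim_row A = dim_row B" "dim_col A = dim_col B" "dim_col B = dim_row C"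
  shows "(A + B) * C = A * C + B * C"
  using add_mult_distrib_mat[of A "dim_row A" "dim_col A" B C "dim_col C"] assms
  by (metis carrier_matI)

lemma mult_add_dim:
  fixes A :: "real mat"
  assumes "dim_row B = dim_row C" "dim_col B = dim_col C" "dim_col A = dim_row B"
  shows "A * (B + C) = A * B + A * C"
  using mult_add_distrib_mat[of A "dim_row A" "dim_col A" B "dim_col B" C] assms
  by (metis carrier_matI)

lemma minus_mult_dim:
  fixes A :: "real mat"
  assumes "dim_row A = dim_row B" "dim_col A = dim_col B" "dim_col B = dim_row C"
  shows "(A - B) * C = A * C - B * C"
  using minus_mult_distrib_mat[of A "dim_row A" "dim_col A" B C "dim_col C"] assms
  by (metis carrier_matI)

lemma mult_minus_dim:
  fixes A :: "real mat"
  assumes "dim_row B = dim_row C" "dim_col B = dim_col C" "dim_col A = dim_row B"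
  shows "A * (B - C) = A * B - A * C"
  using mult_minus_distrib_mat[of A "dim_row A" "dim_col A" B "dim_col B" C] assms
  by (metis carrier_matI)

lemma smult_mult_dim:
  fixes A :: "real mat"
  assumes "dim_col A = dim_row B"
  shows "(c \<cdot>\<^sub>m A) * B = c \<cdot>\<^sub>m (A * B)"
  using mult_smult_assoc_mat[of A "dim_row A" "dim_col A" B "dim_col B"] assms
  by (metis carrier_matI)

lemma mult_smult_dim:
  fixes A :: "real mat"
  assumes "dim_col A = dim_row B"
  shows "A * (c \<cdot>\<^sub>m B) = c \<cdot>\<^sub>m (A * B)"
  using mult_smult_distrib[of A "dim_row A" "dim_col A" B "dim_col B"] assms
  by (metis carrier_matI)

lemma transpose_add_dim:
  fixes A :: "real mat"
  assumes "dim_row A = dim_row B" "dim_col A = dim_col B"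
  shows "(A + B)\<^sup>T = A\<^sup>T + B\<^sup>T"
  using assms by (intro eq_matI) auto

lemma transpose_minus_dim:
  fixes A :: "real mat"
  assumes "dim_row A = dim_row B" "dim_col A = dim_col B"
  shows "(A - B)\<^sup>T = A\<^sup>T - B\<^sup>T"
  using assms by (intro eq_matI) auto

text \<open>As rewrite rules these nest products to the right, push transposes inwards and
  distribute over sums. The side conditions are equations between dimensions, so no intermediate
  dimension has to be guessed as it would be with carrier premises.\<close>

lemmas mat_ring = mult_assoc_dim transpose_mult_dim add_mult_dim mult_add_dim minus_mult_dim
  mult_minus_dim smult_mult_dim mult_smult_dim transpose_add_dim transpose_minus_dim

lemma index_mult_mat_sum:
  fixes A :: "real mat"
  assumes "i < dim_row A" "j < dim_col B" "dim_col A = dim_row B"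
  shows "(A * B) $$ (i, j) = (\<Sum>l<dim_row B. A $$ (i, l) * B $$ (l, j))"
  using assms by (simp add: scalar_prod_def atLeast0LessThan)

subsection \<open>Trace and inverse\<close>

lemma Tr_add: "A \<in> carrier_mat n n \<Longrightarrow> B \<in> carrier_mat n n \<Longrightarrow> Tr (A + B) = Tr A + Tr B"
  by (simp add: Tr_def sum.distrib)

lemma Tr_smult: "A \<in> carrier_mat n n \<Longrightarrow> Tr (c \<cdot>\<^sub>m A) = c * Tr A"
  by (simp add: Tr_def sum_distrib_left)

lemma Tr_transpose: "A \<in> carrier_mat n n \<Longrightarrow> Tr (A\<^sup>T) = Tr A"
  by (simp add: Tr_def)

lemma Tr_mult:
  assumes "A \<in> carrier_mat n m" "B \<in> carrier_mat m n"
  shows "Tr (A * B) = (\<Sum>i<n. \<Sum>j<m. A $$ (i, j) * B $$ (j, i))"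
  using assms by (simp add: Tr_def index_mult_mat_sum del: index_mult_mat(1))

lemma Tr_mult_comm:
  assumes "A \<in> carrier_mat n m" "B \<in> carrier_mat m n"
  shows "Tr (A * B) = Tr (B * A)"
  unfolding Tr_mult[OF assms] Tr_mult[OF assms(2,1)]
  by (subst sum.swap) (simp add: mult.commute)

lemma Tr_mult_transpose:
  assumes "C \<in> carrier_mat q n"
  shows "Tr (C * C\<^sup>T) = (\<Sum>i<q. \<Sum>j<n. (C $$ (i, j))\<^sup>2)"
  using assms by (subst Tr_mult[of _ q n]) (auto simp: power2_eq_square)

lemma Tr_mult_transpose_nonneg: "0 \<le> Tr (C * C\<^sup>T)"
  by (subst Tr_mult_transpose[of C "dim_row C" "dim_col C"]) (auto intro!: sum_nonneg)

lemma Tr_mult_transpose_pos: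
  assumes "C \<in> carrier_mat q n" "C \<noteq> 0\<^sub>m q n"
  shows "0 < Tr (C * C\<^sup>T)"
proof -
  obtain i j where ij: "i < q" "j < n" "C $$ (i, j) \<noteq> 0"
    using assms by (metis eq_matI carrier_matD index_zero_mat)
  have "0 < (C $$ (i, j))\<^sup>2" using ij by simp
  also have "\<dots> \<le> (\<Sum>j<n. (C $$ (i, j))\<^sup>2)" using ij by (intro member_le_sum) auto
  also have "\<dots> \<le> (\<Sum>i<q. \<Sum>j<n. (C $$ (i, j))\<^sup>2)"
    using ij by (intro member_le_sum[of i "{..<q}" "\<lambda>i. \<Sum>j<n. (C $$ (i, j))\<^sup>2"]) (auto intro: sum_nonneg)
  finally show ?thesis using Tr_mult_transpose[OF assms(1)] by simp
qed

lemma minv: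
  assumes "A \<in> carrier_mat n n" "det A \<noteq> 0"
  shows "minv A \<in> carrier_mat n n" "A * minv A = 1\<^sub>m n" "minv A * A = 1\<^sub>m n"
proof -
  have "mat_inverse A \<noteq> None"
    using mat_inverse(1)[OF assms(1), where b = "()"] det_non_zero_imp_unit[OF assms, where b = "()"] by blast
  then obtain B where "mat_inverse A = Some B" by blast
  then show "minv A \<in> carrier_mat n n" "A * minv A = 1\<^sub>m n" "minv A * A = 1\<^sub>m n"
    using mat_inverse(2)[OF assms(1)] by (auto simp: minv_def)
qed

lemma minv_unique:
  assumes "A \<in> carrier_mat n n" "det A \<noteq> 0" "B \<in> carrier_mat n n" "A * B = 1\<^sub>m n"
  shows "B = minv A"
proof -
  have "B = minv A * A * B" using minv[OF assms(1,2)] assms(3) by simp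
  also have "\<dots> = minv A * (A * B)" using minv[OF assms(1,2)] assms by (intro mult_assoc_dim) auto
  finally show ?thesis using minv[OF assms(1,2)] assms(4) by simp
qed

text \<open>Makes the inverse a rational function of the entries, which is what gets differentiated
  later.\<close>

lemma minv_adj_mat:
  assumes "A \<in> carrier_mat n n" "det A \<noteq> 0"
  shows "minv A = (1 / det A) \<cdot>\<^sub>m adj_mat A"
  using assms adj_mat[OF assms(1)]
  by (intro minv_unique[OF assms, symmetric]) (auto simp: mult_smult_dim)

lemma minv_transpose:
  assumes "A \<in> carrier_mat n n" "det A \<noteq> 0" "A\<^sup>T = A"
  shows "(minv A)\<^sup>T = minv A"
proof (rule minv_unique[OF assms(1,2)])
  note I = minv[OF assms(1,2)]
  have "A * (minv A)\<^sup>T = A\<^sup>T * (minv A)\<^sup>T" using assms(3) by simp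
  also have "\<dots> = (minv A * A)\<^sup>T" using I assms(1) by (intro transpose_mult_dim[symmetric]) auto
  finally show "A * (minv A)\<^sup>T = 1\<^sub>m n" using I by simp
qed (use minv[OF assms(1,2)] in auto)

subsection \<open>Row independence and positive definiteness\<close>

text \<open>The coefficients form a matrix with any number q of rows rather than a single vector.
  Differences such as \<open>H\<^sub>0 - H\<close> can thus be tested directly, and arguments remain
  in matrix algebra.\<close>

definition row_independent :: "real mat \<Rightarrow> bool" where
  "row_independent W \<longleftrightarrow>
     (\<forall>q. \<forall>C \<in> carrier_mat q (dim_row W). C * W = 0\<^sub>m q (dim_col W) \<longrightarrow> C = 0\<^sub>m q (dim_row W))"

text \<open>Quadratic forms are replaced by traces over rectangular C, in step with
  \<open>row_independent\<close>; for a Gram matrix the trace becomes a sum of squares of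
  entries.\<close>

definition posdef :: "nat \<Rightarrow> real mat \<Rightarrow> bool" where
  "posdef n M \<longleftrightarrow> M \<in> carrier_mat n n \<and>
     (\<forall>q. \<forall>C \<in> carrier_mat q n. C \<noteq> 0\<^sub>m q n \<longrightarrow> 0 < Tr (C * M * C\<^sup>T))"

lemma row_independentD:
  "row_independent W \<Longrightarrow> W \<in> carrier_mat n t \<Longrightarrow> C \<in> carrier_mat q n \<Longrightarrow> C * W = 0\<^sub>m q t \<Longrightarrow> C = 0\<^sub>m q n"
  unfolding row_independent_def by auto

lemma row_independentI:
  assumes "W \<in> carrier_mat n t"
    and "\<And>q C. C \<in> carrier_mat q n \<Longrightarrow> C * W = 0\<^sub>m q t \<Longrightarrow> C = 0\<^sub>m q n"
  shows "row_independent W"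
  unfolding row_independent_def using assms by auto

lemma posdefD: "posdef n M \<Longrightarrow> C \<in> carrier_mat q n \<Longrightarrow> C \<noteq> 0\<^sub>m q n \<Longrightarrow> 0 < Tr (C * M * C\<^sup>T)"
  unfolding posdef_def by auto

lemma posdef_carrier: "posdef n M \<Longrightarrow> M \<in> carrier_mat n n"
  unfolding posdef_def by auto

lemma posdef_gram:
  assumes "row_independent W" "W \<in> carrier_mat n t"
  shows "posdef n (W * W\<^sup>T)"
  unfolding posdef_def
proof (intro conjI allI ballI impI)
  fix q and C :: "real mat" assume C: "C \<in> carrier_mat q n" "C \<noteq> 0\<^sub>m q n"
  have "C * (W * W\<^sup>T) * C\<^sup>T = (C * W) * (C * W)\<^sup>T"
    using C assms(2) by (simp add: mat_ring)
  moreover have "C * W \<noteq> 0\<^sub>m q t" using row_independentD[OF assms C(1)] C(2) by auto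
  ultimately show "0 < Tr (C * (W * W\<^sup>T) * C\<^sup>T)"
    using Tr_mult_transpose_pos[of "C * W" q t] C assms(2) by simp
qed (use assms in auto)

lemma posdef_det_nonzero:
  assumes "posdef n M"
  shows "det M \<noteq> 0"
proof
  note M = posdef_carrier[OF assms]
  assume "det M = 0"
  then obtain v where v: "v \<in> carrier_vec n" "v \<noteq> 0\<^sub>v n" "M *\<^sub>v v = 0\<^sub>v n"
    using det_0_iff_vec_prod_zero[OF M] by auto
  \<comment> \<open>A kernel vector laid out as a single row: it is a nonzero test matrix whose
    trace form vanishes.\<close>
  define C :: "real mat" where "C = mat 1 n (\<lambda>(i, j). v $ j)"
  have C: "C \<in> carrier_mat 1 n" by (simp add: C_def)
  have "C \<noteq> 0\<^sub>m 1 n"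
  proof
    assume "C = 0\<^sub>m 1 n"
    then have "v $ j = 0" if "j < n" for j
      using that unfolding C_def by (metis index_mat(1) index_zero_mat(1) less_one case_prod_conv)
    then show False using v(1,2) by auto
  qed
  moreover have "M * C\<^sup>T = 0\<^sub>m n 1"
  proof (rule eq_matI)
    fix i j assume "i < dim_row (0\<^sub>m n 1 :: real mat)" "j < dim_col (0\<^sub>m n 1 :: real mat)"
    then have ij: "i < n" "j = 0" by auto
    have "(M * C\<^sup>T) $$ (i, j) = (M *\<^sub>v v) $ i"
      using ij M C v(1) by (simp add: scalar_prod_def C_def)
    then show "(M * C\<^sup>T) $$ (i, j) = 0\<^sub>m n 1 $$ (i, j)" using ij v(3) by simp
  qed (use M C in auto)
  moreover have "C * M * C\<^sup>T = C * (M * C\<^sup>T)" using M C by (simp add: mult_assoc_dim)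
  ultimately have "0 < Tr (C * 0\<^sub>m n 1)" using posdefD[OF assms C] by simp
  also have "C * 0\<^sub>m n 1 = (0\<^sub>m 1 1 :: real mat)" using C by simp
  finally show False by (simp add: Tr_def)
qed

lemma posdef_one: "posdef n (1\<^sub>m n)"
  unfolding posdef_def using Tr_mult_transpose_pos by auto

text \<open>Serves two paths of matrices: the segment from the identity to M in
  \<open>posdef_det_pos\<close>, and the ray that adds multiples of a Gram matrix in
  \<open>det_add_gram_gt\<close>.\<close>

lemma posdef_add_semidef:
  assumes "posdef n P" "N \<in> carrier_mat n n" "0 < a" "0 \<le> b"
    and "\<And>q C. C \<in> carrier_mat q n \<Longrightarrow> 0 \<le> Tr (C * N * C\<^sup>T)"
  shows "posdef n (a \<cdot>\<^sub>m P + b \<cdot>\<^sub>m N)"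
  unfolding posdef_def
proof (intro conjI allI ballI impI)
  note P = posdef_carrier[OF assms(1)]
  fix q and C :: "real mat" assume C: "C \<in> carrier_mat q n" "C \<noteq> 0\<^sub>m q n"
  have "C * (a \<cdot>\<^sub>m P + b \<cdot>\<^sub>m N) * C\<^sup>T = a \<cdot>\<^sub>m (C * P * C\<^sup>T) + b \<cdot>\<^sub>m (C * N * C\<^sup>T)"
    using P assms(2) C by (simp add: mat_ring)
  also have "Tr \<dots> = a * Tr (C * P * C\<^sup>T) + b * Tr (C * N * C\<^sup>T)"
    using P assms(2) C by (subst Tr_add[of _ q]) (auto simp: Tr_smult[of _ q])
  finally show "0 < Tr (C * (a \<cdot>\<^sub>m P + b \<cdot>\<^sub>m N) * C\<^sup>T)"
    using posdefD[OF assms(1) C] assms(3,4) assms(5)[OF C(1)] by (simp add: add_pos_nonneg)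
qed (use assms(2) in auto)

text \<open>With \<open>D = M\<^sup>-\<^sup>1 C\<close> one has \<open>C\<^sup>T M\<^sup>-\<^sup>1 C = (D\<^sup>T M D)\<^sup>T\<close>.\<close>

lemma posdef_Tr_minv_pos:
  fixes C :: "real mat"
  assumes "posdef n M" "C \<in> carrier_mat n q" "C \<noteq> 0\<^sub>m n q"
  shows "0 < Tr (minv M * (C * C\<^sup>T))"
proof -
  note M = posdef_carrier[OF assms(1)]
  note I = minv[OF M posdef_det_nonzero[OF assms(1)]]
  define D where "D = minv M * C"
  have D: "D \<in> carrier_mat n q" using I assms(2) by (auto simp: D_def)
  have MD: "M * D = C"
    unfolding D_def using I M assms(2) by (simp flip: mult_assoc_dim)
  have "D\<^sup>T \<noteq> 0\<^sub>m q n"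
  proof
    assume "D\<^sup>T = 0\<^sub>m q n"
    then have "D = (0\<^sub>m q n)\<^sup>T" by (metis transpose_transpose)
    then have "D = 0\<^sub>m n q" by (metis zero_transpose_mat)
    then show False using MD M assms(3) by simp
  qed
  then have "0 < Tr (D\<^sup>T * M * (D\<^sup>T)\<^sup>T)" using D by (intro posdefD[OF assms(1)]) auto
  also have "D\<^sup>T * M * (D\<^sup>T)\<^sup>T = D\<^sup>T * C" using D M MD by (simp add: mult_assoc_dim)
  also have "Tr (D\<^sup>T * C) = Tr ((D\<^sup>T * C)\<^sup>T)" using D assms(2) by (intro Tr_transpose[symmetric]) auto
  also have "(D\<^sup>T * C)\<^sup>T = C\<^sup>T * D" using D assms(2) by (simp add: mat_ring)
  also have "Tr (C\<^sup>T * D) = Tr (D * C\<^sup>T)" using D assms(2) by (intro Tr_mult_comm) auto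
  also have "D * C\<^sup>T = minv M * (C * C\<^sup>T)" unfolding D_def using I assms(2) by (simp add: mult_assoc_dim)
  finally show ?thesis .
qed

section \<open>Derivatives of matrix curves, determinants and inverses\<close>

text \<open>Differentiability is entrywise since matrices of all sizes share one type. The curve has
  fixed dimensions for every s, so products along it make sense away from x as well.\<close>

definition mat_deriv :: "nat \<Rightarrow> nat \<Rightarrow> (real \<Rightarrow> real mat) \<Rightarrow> real mat \<Rightarrow> real \<Rightarrow> bool" where
  "mat_deriv n m F D x \<longleftrightarrow> (\<forall>s. F s \<in> carrier_mat n m) \<and> D \<in> carrier_mat n m \<and>
     (\<forall>i<n. \<forall>j<m. ((\<lambda>s. F s $$ (i, j)) has_real_derivative D $$ (i, j)) (at x))"

lemma mat_deriv_carrier: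
  "mat_deriv n m F D x \<Longrightarrow> F s \<in> carrier_mat n m"
  "mat_deriv n m F D x \<Longrightarrow> D \<in> carrier_mat n m"
  by (auto simp: mat_deriv_def)

lemma mat_deriv_dim:
  assumes "mat_deriv n m F D x"
  shows "dim_row (F s) = n" "dim_col (F s) = m" "dim_row D = n" "dim_col D = m"
  using mat_deriv_carrier[OF assms] by auto

lemma mat_derivD:
  "mat_deriv n m F D x \<Longrightarrow> i < n \<Longrightarrow> j < m \<Longrightarrow>
     ((\<lambda>s. F s $$ (i, j)) has_real_derivative D $$ (i, j)) (at x)"
  by (auto simp: mat_deriv_def)

lemma mat_deriv_cong: "mat_deriv n m F D x \<Longrightarrow> D = D' \<Longrightarrow> mat_deriv n m F D' x"
  by simp

lemma mat_deriv_const: "A \<in> carrier_mat n m \<Longrightarrow> mat_deriv n m (\<lambda>s. A) (0\<^sub>m n m) x"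
  by (auto simp: mat_deriv_def)

lemma mat_deriv_line:
  assumes "A \<in> carrier_mat n m" "B \<in> carrier_mat n m"
  shows "mat_deriv n m (\<lambda>s. A + s \<cdot>\<^sub>m B) B x"
  unfolding mat_deriv_def
proof (intro conjI allI impI)
  fix i j assume ij: "i < n" "j < m"
  then have "(A + s \<cdot>\<^sub>m B) $$ (i, j) = A $$ (i, j) + s * B $$ (i, j)" for s
    using assms by simp
  then show "((\<lambda>s. (A + s \<cdot>\<^sub>m B) $$ (i, j)) has_real_derivative B $$ (i, j)) (at x)"
    by (auto intro!: derivative_eq_intros)
qed (use assms in auto)

lemma mat_deriv_transpose:
  assumes "mat_deriv n m F D x"
  shows "mat_deriv m n (\<lambda>s. (F s)\<^sup>T) (D\<^sup>T) x"
  using mat_deriv_carrier[OF assms] mat_derivD[OF assms]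
  by (simp add: mat_deriv_def mat_deriv_dim[OF assms])

lemma mat_deriv_mult:
  assumes "mat_deriv n l F D x" "mat_deriv l m G E x"
  shows "mat_deriv n m (\<lambda>s. F s * G s) (D * G x + F x * E) x"
  unfolding mat_deriv_def
proof (intro conjI allI impI)
  note c = mat_deriv_carrier[OF assms(1)] mat_deriv_carrier[OF assms(2)]
    and d = mat_deriv_dim[OF assms(1)] mat_deriv_dim[OF assms(2)]
  fix i j assume ij: "i < n" "j < m"
  have FG: "(F s * G s) $$ (i, j) = (\<Sum>q<l. F s $$ (i, q) * G s $$ (q, j))" for s
    using ij by (subst index_mult_mat_sum) (simp_all add: d)
  have "(D * G x + F x * E) $$ (i, j) = (D * G x) $$ (i, j) + (F x * E) $$ (i, j)"
    using ij by (intro index_add_mat) (simp_all add: d)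
  also have "\<dots> = (\<Sum>q<l. D $$ (i, q) * G x $$ (q, j)) + (\<Sum>q<l. F x $$ (i, q) * E $$ (q, j))"
    using ij by (simp add: d index_mult_mat_sum del: index_mult_mat(1))
  also have "\<dots> = (\<Sum>q<l. D $$ (i, q) * G x $$ (q, j) + E $$ (q, j) * F x $$ (i, q))"
    by (simp add: sum.distrib mult.commute)
  finally have E: "(D * G x + F x * E) $$ (i, j) = \<dots>" .
  show "((\<lambda>s. (F s * G s) $$ (i, j)) has_real_derivative (D * G x + F x * E) $$ (i, j)) (at x)"
    unfolding FG E using ij
    by (intro DERIV_sum DERIV_mult mat_derivD[OF assms(1)] mat_derivD[OF assms(2)]) auto
qed (use mat_deriv_dim[OF assms(1)] mat_deriv_dim[OF assms(2)] in \<open>auto intro!: carrier_matI\<close>)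

lemma mat_deriv_mult_const_right:
  assumes "mat_deriv n l F D x" "B \<in> carrier_mat l m"
  shows "mat_deriv n m (\<lambda>s. F s * B) (D * B) x"
  by (rule mat_deriv_cong[OF mat_deriv_mult[OF assms(1) mat_deriv_const[OF assms(2)]]])
    (use mat_deriv_carrier(1)[OF assms(1), of x] mat_deriv_carrier(2)[OF assms(1)] assms(2) in auto)

lemma Tr_deriv:
  assumes "mat_deriv n n F D x"
  shows "((\<lambda>s. Tr (F s)) has_real_derivative Tr D) (at x)"
proof -
  have "dim_row (F s) = n" "dim_row D = n" for s
    using mat_deriv_carrier[OF assms] by auto
  then show ?thesis
    unfolding Tr_def by (auto intro!: DERIV_sum mat_derivD[OF assms])
qed

text \<open>Laplace expansion along row i: the cofactors of that row never see its entries, so they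
  are those of A.\<close>

lemma det_replace_row:
  fixes A B :: "real mat"
  assumes "A \<in> carrier_mat n n" "i < n"
  shows "det (mat n n (\<lambda>(a, b). if a = i then B $$ (i, b) else A $$ (a, b)))
    = (\<Sum>j<n. B $$ (i, j) * cofactor A i j)" (is "det ?R = _")
proof -
  have "mat_delete ?R i j = mat_delete A i j" if "j < n" for j
    using assms that by (auto simp: mat_delete_def)
  then show ?thesis
    using laplace_expansion_row[of ?R n i] assms by (simp add: cofactor_def)
qed

text \<open>Jacobi's formula: in the Leibniz expansion, differentiating the factor of row \<open>i\<close> gives the
  determinant with row \<open>i\<close> replaced by its derivative.\<close>

lemma det_deriv:
  assumes "mat_deriv n n F D x"
  shows "((\<lambda>s. det (F s)) has_real_derivative Tr (adj_mat (F x) * D)) (at x)"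
proof -
  note c = mat_deriv_carrier[OF assms]
  let ?P = "{p. p permutes {0..<n}}"
  let ?R = "\<lambda>i. mat n n (\<lambda>(a, b). if a = i then D $$ (i, b) else F x $$ (a, b))"
  have det: "det (F s) = (\<Sum>p\<in>?P. signof p * (\<Prod>i=0..<n. F s $$ (i, p i)))" for s
    by (rule det_def'[OF c(1)])
  have lt: "p i < n" if "p \<in> ?P" "i < n" for p i
    using that permutes_in_image[of p "{0..<n}" i] by auto
  have R: "D $$ (i, p i) * (\<Prod>a\<in>{0..<n} - {i}. F x $$ (a, p a)) = (\<Prod>a=0..<n. ?R i $$ (a, p a))"
    if "p \<in> ?P" "i < n" for p i
  proof -
    have "(\<Prod>a=0..<n. ?R i $$ (a, p a)) = ?R i $$ (i, p i) * (\<Prod>a\<in>{0..<n} - {i}. ?R i $$ (a, p a))"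
      using that by (intro prod.remove) auto
    also have "(\<Prod>a\<in>{0..<n} - {i}. ?R i $$ (a, p a)) = (\<Prod>a\<in>{0..<n} - {i}. F x $$ (a, p a))"
      using that lt by (intro prod.cong) auto
    finally show ?thesis using that lt by simp
  qed
  have "((\<lambda>s. det (F s)) has_real_derivative
      (\<Sum>p\<in>?P. signof p * (\<Sum>i\<in>{0..<n}. D $$ (i, p i) * (\<Prod>a\<in>{0..<n} - {i}. F x $$ (a, p a))))) (at x)"
    unfolding det using lt
    by (intro DERIV_sum DERIV_cmult has_field_derivative_prod mat_derivD[OF assms]) auto
  also have "(\<Sum>p\<in>?P. signof p * (\<Sum>i\<in>{0..<n}. D $$ (i, p i) * (\<Prod>a\<in>{0..<n} - {i}. F x $$ (a, p a))))
      = (\<Sum>p\<in>?P. \<Sum>i\<in>{0..<n}. signof p * (\<Prod>a=0..<n. ?R i $$ (a, p a)))"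
    unfolding sum_distrib_left using R by (intro sum.cong) auto
  also have "\<dots> = (\<Sum>i\<in>{0..<n}. det (?R i))"
    by (subst sum.swap) (simp add: det_def'[of _ n])
  also have "\<dots> = (\<Sum>i<n. \<Sum>j<n. D $$ (i, j) * cofactor (F x) i j)"
    using det_replace_row[OF c(1)] by (simp add: atLeast0LessThan)
  \<comment> \<open>Entry (j, i) of the adjugate is the cofactor at (i, j), so the double sum is a
    trace.\<close>
  also have "\<dots> = Tr (D * adj_mat (F x))"
    using c adj_mat(1)[OF c(1)]
    by (subst Tr_mult[of _ n n]) (simp_all add: adj_mat_def mat_deriv_dim[OF assms])
  also have "\<dots> = Tr (adj_mat (F x) * D)"
    using c adj_mat(1)[OF c(1)] by (intro Tr_mult_comm) auto
  finally show ?thesis .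
qed

lemma det_isCont: "mat_deriv n n F D x \<Longrightarrow> isCont (\<lambda>s. det (F s)) x"
  using DERIV_isCont[OF det_deriv] .

lemma det_deriv_minv:
  assumes "mat_deriv n n F D x" "det (F x) \<noteq> 0"
  shows "((\<lambda>s. det (F s)) has_real_derivative det (F x) * Tr (minv (F x) * D)) (at x)"
proof -
  note c = mat_deriv_carrier[OF assms(1)] and a = adj_mat(1)[OF mat_deriv_carrier(1)[OF assms(1)]]
  have "minv (F x) * D = (1 / det (F x)) \<cdot>\<^sub>m (adj_mat (F x) * D)"
    unfolding minv_adj_mat[OF c(1) assms(2)] using c(2) a[of x] by (intro smult_mult_dim) auto
  then have "Tr (minv (F x) * D) = Tr (adj_mat (F x) * D) / det (F x)"
    using a[of x] c(2) by (simp add: Tr_smult[of _ n])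
  then show ?thesis using det_deriv[OF assms(1)] assms(2) by simp
qed

lemma mat_delete_deriv:
  assumes "mat_deriv n n F D x" "i < n" "j < n"
  shows "mat_deriv (n - 1) (n - 1) (\<lambda>s. mat_delete (F s) i j) (mat_delete D i j) x"
  unfolding mat_deriv_def
proof (intro conjI allI impI)
  fix a b assume ab: "a < n - 1" "b < n - 1"
  let ?a = "if a < i then a else Suc a" and ?b = "if b < j then b else Suc b"
  have "mat_delete M i j $$ (a, b) = M $$ (?a, ?b)" if "dim_row M = n" "dim_col M = n" for M :: "real mat"
    using ab that unfolding mat_delete_def by simp
  moreover have "((\<lambda>s. F s $$ (?a, ?b)) has_real_derivative D $$ (?a, ?b)) (at x)"
    using ab by (intro mat_derivD[OF assms(1)]) auto
  ultimately show "((\<lambda>s. mat_delete (F s) i j $$ (a, b)) has_real_derivative mat_delete D i j $$ (a, b)) (at x)"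
    by (simp add: mat_deriv_dim[OF assms(1)])
qed (use mat_delete_carrier[OF mat_deriv_carrier(1)[OF assms(1)]]
    mat_delete_carrier[OF mat_deriv_carrier(2)[OF assms(1)]] in auto)

text \<open>Only existence is claimed: each entry is a cofactor divided by the determinant. The
  value of the derivative follows in \<open>minv_deriv\<close> from the product rule, without
  computing with cofactors.\<close>

lemma minv_differentiable:
  assumes "mat_deriv n n F D x" "det (F x) \<noteq> 0"
  obtains E where "mat_deriv n n (\<lambda>s. (1 / det (F s)) \<cdot>\<^sub>m adj_mat (F s)) E x"
proof -
  note c = mat_deriv_carrier[OF assms(1)] and a = adj_mat(1)[OF mat_deriv_carrier(1)[OF assms(1)]]
  let ?I = "\<lambda>s. (1 / det (F s)) \<cdot>\<^sub>m adj_mat (F s)"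
  \<comment> \<open>\<open>deriv\<close> merely names the entrywise derivatives so that they can be
    collected in one matrix.\<close>
  define e where "e i j = deriv (\<lambda>s. ?I s $$ (i, j)) x" for i j
  have e: "((\<lambda>s. ?I s $$ (i, j)) has_real_derivative e i j) (at x)" if "i < n" "j < n" for i j
  proof -
    have "?I s $$ (i, j) = 1 / det (F s) * ((-1) ^ (j + i) * det (mat_delete (F s) j i))" for s
      using a[of s] c(1)[of s] that by (simp add: adj_mat_def cofactor_def)
    moreover have "\<exists>y. ((\<lambda>s. 1 / det (F s) * ((-1) ^ (j + i) * det (mat_delete (F s) j i))) has_real_derivative y) (at x)"
      by (rule exI, rule DERIV_mult, rule DERIV_divide[OF DERIV_const det_deriv[OF assms(1)] assms(2)],
        rule DERIV_cmult[OF det_deriv[OF mat_delete_deriv[OF assms(1) that(2,1)]]])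
    ultimately have "\<exists>y. ((\<lambda>s. ?I s $$ (i, j)) has_real_derivative y) (at x)" by simp
    then obtain y where "((\<lambda>s. ?I s $$ (i, j)) has_real_derivative y) (at x)" ..
    moreover from this have "y = e i j" unfolding e_def by (rule DERIV_imp_deriv[symmetric])
    ultimately show ?thesis by simp
  qed
  have "mat_deriv n n ?I (mat n n (\<lambda>(i, j). e i j)) x"
    unfolding mat_deriv_def using smult_carrier_mat[OF a] e by simp
  then show thesis by (rule that)
qed

text \<open>Stated for \<open>nhds\<close>, which includes the point itself, because that is the
  form in which \<open>DERIV_cong_ev\<close> exchanges two functions.\<close>

lemma eventually_det_nonzero:
  assumes "mat_deriv n n F D x" "det (F x) \<noteq> 0"
  shows "\<forall>\<^sub>F s in nhds x. det (F s) \<noteq> 0"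
proof -
  have "\<forall>\<^sub>F s in at x. det (F s) \<noteq> 0"
    using det_isCont[OF assms(1)] assms(2) tendsto_imp_eventually_ne unfolding isCont_def by blast
  then show ?thesis using assms(2) by (simp add: eventually_nhds_conv_at)
qed

text \<open>Off the regular matrices \<open>minv\<close> is unspecified, so the curve of inverses is represented by
  the adjugate formula.\<close>

lemma minv_deriv:
  assumes "mat_deriv n n F D x" "det (F x) \<noteq> 0"
  shows "mat_deriv n n (\<lambda>s. (1 / det (F s)) \<cdot>\<^sub>m adj_mat (F s)) (- (minv (F x) * D * minv (F x))) x"
proof -
  note c = mat_deriv_carrier[OF assms(1)]
  let ?I = "\<lambda>s. (1 / det (F s)) \<cdot>\<^sub>m adj_mat (F s)"
  note I = minv[OF c(1) assms(2)]
  obtain E where E: "mat_deriv n n ?I E x"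
    using minv_differentiable[OF assms] .
  note Ec = mat_deriv_carrier(2)[OF E]
  have Ix: "?I x = minv (F x)" using minv_adj_mat[OF c(1) assms(2)] by simp
  note P = mat_deriv_mult[OF assms(1) E, unfolded Ix]
  \<comment> \<open>The product of the curve with its inverse is constantly the identity near x, so
    its derivative, written out by the product rule, must vanish.\<close>
  have "D * minv (F x) + F x * E = 0\<^sub>m n n"
  proof (rule eq_matI)
    fix i j assume "i < dim_row (0\<^sub>m n n :: real mat)" "j < dim_col (0\<^sub>m n n :: real mat)"
    then have ij: "i < n" "j < n" by auto
    have "((\<lambda>s. (F s * ?I s) $$ (i, j)) has_real_derivative 0) (at x)"
    proof (rule DERIV_cong_ev[THEN iffD2, OF refl _ refl])
      show "\<forall>\<^sub>F s in nhds x. (F s * ?I s) $$ (i, j) = 1\<^sub>m n $$ (i, j)"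
        using eventually_det_nonzero[OF assms]
      proof eventually_elim
        case (elim s)
        show ?case using minv(2)[OF c(1) elim] minv_adj_mat[OF c(1) elim] by simp
      qed
    qed simp
    then show "(D * minv (F x) + F x * E) $$ (i, j) = 0\<^sub>m n n $$ (i, j)"
      using DERIV_unique[OF mat_derivD[OF P ij]] ij by simp
  qed (use c Ec in auto)
  then have "minv (F x) * (D * minv (F x) + F x * E) = 0\<^sub>m n n" using I by simp
  moreover have "minv (F x) * (D * minv (F x) + F x * E) = minv (F x) * D * minv (F x) + E"
  proof -
    have "minv (F x) * (F x * E) = E"
      using I c Ec carrier_matD[OF c(1)[of x]] by (simp flip: mult_assoc_dim)
    then show ?thesis using I c Ec carrier_matD[OF c(1)[of x]] by (simp add: mat_ring)
  qed
  ultimately have S: "minv (F x) * D * minv (F x) + E = 0\<^sub>m n n" by simp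
  have "E = - (minv (F x) * D * minv (F x))"
  proof (rule eq_matI)
    fix i j assume "i < dim_row (- (minv (F x) * D * minv (F x)))" "j < dim_col (- (minv (F x) * D * minv (F x)))"
    then have ij: "i < n" "j < n" using I by auto
    have "(minv (F x) * D * minv (F x)) $$ (i, j) + E $$ (i, j) = 0"
      using arg_cong[OF S, of "\<lambda>M. M $$ (i, j)"] ij Ec I c
      by (metis carrier_matD index_add_mat(1) index_zero_mat(1))
    then show "E $$ (i, j) = (- (minv (F x) * D * minv (F x))) $$ (i, j)"
      using ij I by simp
  qed (use I Ec in auto)
  then show ?thesis using E by simp
qed

subsection \<open>Determinants of positive definite matrices\<close>

text \<open>The segment from the identity to M consists of positive definite matrices, where the
  determinant cannot vanish. Being continuous and equal to 1 at the start, it cannot reach a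
  nonpositive value at M.\<close>

lemma posdef_det_pos:
  assumes "posdef n M"
  shows "0 < det M"
proof (rule ccontr)
  note M = posdef_carrier[OF assms]
  let ?F = "\<lambda>t. 1\<^sub>m n + t \<cdot>\<^sub>m (M - 1\<^sub>m n)"
  assume "\<not> 0 < det M"
  moreover have "?F 1 = M" "?F 0 = 1\<^sub>m n" using M by auto
  ultimately have "det (?F 1) \<le> 0" "0 \<le> det (?F 0)" by auto
  moreover have "mat_deriv n n ?F (M - 1\<^sub>m n) t" for t
    using M by (intro mat_deriv_line) auto
  then have "isCont (\<lambda>t. det (?F t)) t" for t by (rule det_isCont)
  ultimately obtain t where t: "0 \<le> t" "t \<le> 1" "det (?F t) = 0"
    using IVT2[of "\<lambda>t. det (?F t)" 1 0 0] by auto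
  have "posdef n (?F t)"
  \<comment> \<open>For t < 1 the identity has positive weight 1 - t, as
    \<open>posdef_add_semidef\<close> demands; at the end point the matrix is M itself.\<close>
  proof (cases "t = 1")
    case False
    then have "posdef n ((1 - t) \<cdot>\<^sub>m 1\<^sub>m n + t \<cdot>\<^sub>m M)"
    proof (intro posdef_add_semidef posdef_one)
      show "0 \<le> Tr (C * M * C\<^sup>T)" if C: "C \<in> carrier_mat q n" for q C
      proof (cases "C = 0\<^sub>m q n")
        case True
        then have "C * M = 0\<^sub>m q n" using M by simp
        then show ?thesis using True by (simp add: Tr_def)
      qed (use posdefD[OF assms C] in simp)
    qed (use t M False in auto)
    also have "(1 - t) \<cdot>\<^sub>m 1\<^sub>m n + t \<cdot>\<^sub>m M = ?F t"
      using M by (intro eq_matI) (auto simp: algebra_simps)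
    finally show ?thesis .
  qed (use \<open>?F 1 = M\<close> assms in simp)
  then show False using posdef_det_nonzero t(3) by blast
qed

lemma det_add_gram_gt:
  assumes "posdef n P" "C \<in> carrier_mat n q" "C \<noteq> 0\<^sub>m n q"
  shows "det P < det (P + C * C\<^sup>T)"
proof -
  note P = posdef_carrier[OF assms(1)]
  let ?F = "\<lambda>t. P + t \<cdot>\<^sub>m (C * C\<^sup>T)"
  have F: "mat_deriv n n ?F (C * C\<^sup>T) t" for t
    using P assms(2) by (intro mat_deriv_line) auto
  have "0 \<le> Tr (D * (C * C\<^sup>T) * D\<^sup>T)" if "D \<in> carrier_mat r n" for D r
  proof -
    have "D * (C * C\<^sup>T) * D\<^sup>T = (D * C) * (D * C)\<^sup>T"
      using that assms(2) by (simp add: mat_ring)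
    then show ?thesis by (simp add: Tr_mult_transpose_nonneg)
  qed
  then have "posdef n (1 \<cdot>\<^sub>m P + t \<cdot>\<^sub>m (C * C\<^sup>T))" if "0 \<le> t" for t
    using that assms P by (intro posdef_add_semidef) auto
  moreover have "1 \<cdot>\<^sub>m P = P" using P by auto
  ultimately have pd: "posdef n (?F t)" if "0 \<le> t" for t using that by simp
  have "det (?F 0) < det (?F 1)"
  proof (rule DERIV_pos_imp_increasing[where f = "\<lambda>t. det (?F t)"])
    fix t :: real assume "0 \<le> t" "t \<le> 1"
    note pt = pd[OF this(1)]
    \<comment> \<open>The derivative is the determinant times Tr of the inverse times C C', and both
      factors are positive all along the ray.\<close>
    show "\<exists>y. ((\<lambda>t. det (?F t)) has_real_derivative y) (at t) \<and> 0 < y"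
      using det_deriv_minv[OF F posdef_det_nonzero[OF pt]] posdef_det_pos[OF pt]
        posdef_Tr_minv_pos[OF pt assms(2,3)] by (blast intro: mult_pos_pos)
  qed simp
  moreover have "?F 0 = P" "?F 1 = P + C * C\<^sup>T" using P assms(2) by auto
  ultimately show ?thesis by simp
qed

section \<open>Full row rank and independence of rows\<close>

text \<open>If the rank is n, then n of the columns form a basis, and a row of C that annihilates
  all columns is orthogonal to the whole space, hence to itself. Conversely, independent rows make
  the Gram matrix invertible, which exhibits a preimage of every vector.\<close>

lemma full_row_rank_iff: "full_row_rank A \<longleftrightarrow> row_independent A"
proof -
  define n nc where "n = dim_row A" and "nc = dim_col A"
  have A: "A \<in> carrier_mat n nc" by (simp add: n_def nc_def)
  interpret vec_space "TYPE(real)" n .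
  have cols: "set (cols A) \<subseteq> carrier_vec n" using cols_dim[of A] A by auto
  have "row_independent A" if "rank A = n"
  proof (rule row_independentI[OF A])
    fix q and C :: "real mat" assume C: "C \<in> carrier_mat q n" "C * A = 0\<^sub>m q nc"
    let ?P = "\<lambda>T. T \<subseteq> set (cols A) \<and> lin_indpt T"
    have "lin_indpt {}" by (simp add: lin_dep_def)
    then have "?P {}" by simp
    \<comment> \<open>The rank is the size of a maximal independent set of columns, so S has n
      elements and spans everything.\<close>
    then obtain S where S: "finite S" "maximal S ?P"
      using maximal_exists_superset[OF finite_set[of "cols A"], of ?P "{}"] by blast
    from S(2) have S': "S \<subseteq> set (cols A)" "lin_indpt S" unfolding maximal_def by blast+
    have SV: "S \<subseteq> carrier_vec n" using S'(1) cols by blast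
    have "card S = n" using rank_card_indpt[OF A S(2)] that by simp
    then have "basis S"
      using dim_li_is_basis[OF fin_dim S(1) _ S'(2)] SV by (simp add: dim_is_n)
    then have span: "span S = carrier_vec n" unfolding basis_def by simp
    show "C = 0\<^sub>m q n"
    proof (rule eq_matI)
      fix i j assume "i < dim_row (0\<^sub>m q n :: real mat)" "j < dim_col (0\<^sub>m q n :: real mat)"
      then have ij: "i < q" "j < n" by auto
      let ?x = "row C i"
      have x: "?x \<in> carrier_vec n" using C ij by auto
      have "?x \<bullet> y = 0" if "y \<in> S" for y
      proof -
        have "y \<in> set (cols A)" using that S'(1) by blast
        then obtain l where l: "l < nc" "y = col A l"
          using A unfolding cols_def by auto
        then have "?x \<bullet> y = (C * A) $$ (i, l)" using C(1) A ij by simp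
        then show ?thesis using C(2) l ij by simp
      qed
      then have "?x \<in> orthogonal_complement S" using x by (simp add: orthogonal_complement_def)
      then have "?x \<in> orthogonal_complement (carrier_vec n)"
        using in_orthogonal_complement_span[OF SV] unfolding span by simp
      then have "?x \<bullet> ?x = 0" using x unfolding orthogonal_complement_def by blast
      then have "(\<Sum>l<n. (C $$ (i, l))\<^sup>2) = 0"
        using C(1) ij by (simp add: scalar_prod_def power2_eq_square atLeast0LessThan)
      then show "C $$ (i, j) = 0\<^sub>m q n $$ (i, j)"
        using ij by (simp add: sum_nonneg_eq_0_iff)
    qed (use C in auto)
  qed
  moreover have "rank A = n" if "row_independent A"
  proof -
    let ?M = "A * A\<^sup>T"
    have M: "?M \<in> carrier_mat n n" using A by simp
    note I = minv[OF M posdef_det_nonzero[OF posdef_gram[OF that A]]]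
    \<comment> \<open>The preimage is A' (A A')^-1 w, the right inverse of A applied to w.\<close>
    have "w \<in> col_space A" if w: "w \<in> carrier_vec n" for w
    proof -
      have u: "minv ?M *\<^sub>v w \<in> carrier_vec n" using I(1) w by (rule mult_mat_vec_carrier)
      have "A *\<^sub>v (A\<^sup>T *\<^sub>v (minv ?M *\<^sub>v w)) = ?M *\<^sub>v (minv ?M *\<^sub>v w)"
        using A u by (intro assoc_mult_mat_vec[symmetric]) auto
      also have "\<dots> = ?M * minv ?M *\<^sub>v w"
        using M I(1) w by (intro assoc_mult_mat_vec[symmetric]) auto
      also have "\<dots> = w" unfolding I(2) using w by simp
      finally have Au: "A *\<^sub>v (A\<^sup>T *\<^sub>v (minv ?M *\<^sub>v w)) = w" .
      have "A\<^sup>T *\<^sub>v (minv ?M *\<^sub>v w) \<in> carrier_vec (dim_col A)"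
        by (rule mult_mat_vec_carrier[OF _ u]) (use A in auto)
      then show ?thesis
        unfolding col_space_eq[OF A] using A w Au by blast
    qed
    then have "span (set (cols A)) = carrier_vec n"
      using span_closed cols unfolding col_space_def by auto
    \<comment> \<open>The rank is the dimension of the column span as a subspace; with the span
      equal to all vectors, that subspace is the ambient space of dimension n.\<close>
    moreover have "vs (carrier_vec n) = V" by (simp add: module_vec_def)
    ultimately show ?thesis unfolding rank_def by (simp only: dim_is_n)
  qed
  ultimately show ?thesis unfolding full_row_rank_def n_def[symmetric] by auto
qed

subsection \<open>Derivatives of the log-determinant\<close>

text \<open>\<open>kappa\<close> maps lines to lines, so the calculus is done for an arbitrary
  matrix K moving along a line; \<open>grad_term\<close> and \<open>hess_term\<close> are the
  instances at \<open>kappa p d m G\<close>.\<close>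

definition ld_grad :: "real mat \<Rightarrow> real mat \<Rightarrow> real mat \<Rightarrow> real" where
  "ld_grad U K L = 2 * Tr (minv (K * U * K\<^sup>T) * K * U * L\<^sup>T)"

definition ld_hess :: "real mat \<Rightarrow> real mat \<Rightarrow> real mat \<Rightarrow> real mat \<Rightarrow> real" where
  "ld_hess U K P L = 2 * Tr (minv (K * U * K\<^sup>T) * P * U * L\<^sup>T
     - minv (K * U * K\<^sup>T) * (K * U * P\<^sup>T + P * U * K\<^sup>T) * minv (K * U * K\<^sup>T) * K * U * L\<^sup>T)"

lemma add_zero_smult:
  assumes "K \<in> carrier_mat n N" "L \<in> carrier_mat n N"
  shows "K + 0 \<cdot>\<^sub>m L = (K :: real mat)"
  using assms by (intro eq_matI) auto

lemma congruence_deriv: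
  assumes "K \<in> carrier_mat n N" "L \<in> carrier_mat n N" "U \<in> carrier_mat N N"
  shows "mat_deriv n n (\<lambda>s. (K + s \<cdot>\<^sub>m L) * U * (K + s \<cdot>\<^sub>m L)\<^sup>T) (L * U * K\<^sup>T + K * U * L\<^sup>T) 0"
  using mat_deriv_mult[OF mat_deriv_mult_const_right[OF mat_deriv_line[OF assms(1,2)] assms(3)]
      mat_deriv_transpose[OF mat_deriv_line[OF assms(1,2)]], of 0]
  by (simp only: add_zero_smult[OF assms(1,2)])

text \<open>The derivative of K U K' has two summands that are transposes of each other. Against the
  symmetric inverse they have the same trace, which is where the factor 2 comes from.\<close>

lemma ln_det_congruence_deriv:
  assumes K: "K \<in> carrier_mat n N" and L: "L \<in> carrier_mat n N"
    and U: "U \<in> carrier_mat N N" "U\<^sup>T = U" and pos: "0 < det (K * U * K\<^sup>T)"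
  shows "((\<lambda>s. ln (det ((K + s \<cdot>\<^sub>m L) * U * (K + s \<cdot>\<^sub>m L)\<^sup>T))) has_real_derivative ld_grad U K L) (at 0)"
proof -
  let ?M = "K * U * K\<^sup>T"
  let ?F = "\<lambda>s. (K + s \<cdot>\<^sub>m L) * U * (K + s \<cdot>\<^sub>m L)\<^sup>T"
  have F0: "?F 0 = ?M" by (simp only: add_zero_smult[OF K L])
  have M: "?M \<in> carrier_mat n n" using K U by simp
  have MT: "?M\<^sup>T = ?M" using K U by (simp add: mat_ring)
  note I = minv[OF M less_imp_neq[OF pos, symmetric]]
  have IT: "(minv ?M)\<^sup>T = minv ?M" by (rule minv_transpose[OF M less_imp_neq[OF pos, symmetric] MT])
  have "Tr (minv ?M * (L * U * K\<^sup>T)) = Tr ((minv ?M * (L * U * K\<^sup>T))\<^sup>T)"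
    using I K L U by (intro Tr_transpose[symmetric]) auto
  also have "(minv ?M * (L * U * K\<^sup>T))\<^sup>T = (K * U * L\<^sup>T) * minv ?M"
    using I K L U IT by (simp add: mat_ring)
  also have "Tr \<dots> = Tr (minv ?M * (K * U * L\<^sup>T))"
    using I K L U by (intro Tr_mult_comm) auto
  finally have "Tr (minv ?M * (L * U * K\<^sup>T + K * U * L\<^sup>T)) = 2 * Tr (minv ?M * (K * U * L\<^sup>T))"
    using I K L U by (subst mult_add_dim; (simp add: Tr_add[of _ n])?)
  also have "minv ?M * (K * U * L\<^sup>T) = minv ?M * K * U * L\<^sup>T"
    using I K L U by (simp add: mult_assoc_dim)
  finally have Tr: "Tr (minv ?M * (L * U * K\<^sup>T + K * U * L\<^sup>T)) = ld_grad U K L"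
    by (simp add: ld_grad_def)
  have d: "((\<lambda>s. det (?F s)) has_real_derivative det ?M * ld_grad U K L) (at 0)"
    using det_deriv_minv[OF congruence_deriv[OF K L U(1)]] pos F0 Tr by simp
  have "0 < det (?F 0)" unfolding F0 by (rule pos)
  from DERIV_chain2[OF DERIV_ln[OF this] d]
  have "((\<lambda>s. ln (det (?F s))) has_real_derivative
      inverse (det ?M) * (det ?M * ld_grad U K L)) (at 0)" unfolding F0 .
  moreover have "inverse (det ?M) * (det ?M * ld_grad U K L) = ld_grad U K L"
    by (simp only: mult.assoc[symmetric] left_inverse[OF less_imp_neq[OF pos, symmetric]] mult_1_left)
  ultimately show ?thesis by (simp only:)
qed

text \<open>With L fixed, only the inverse and the factor K next to it depend on s. Moving K gives
  the first term of \<open>ld_hess\<close>, moving the inverse gives the second with its minus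
  sign.\<close>

lemma ld_grad_deriv:
  assumes K: "K \<in> carrier_mat n N" and P: "P \<in> carrier_mat n N" and L: "L \<in> carrier_mat n N"
    and U: "U \<in> carrier_mat N N" and nz: "det (K * U * K\<^sup>T) \<noteq> 0"
  shows "((\<lambda>s. ld_grad U (K + s \<cdot>\<^sub>m P) L) has_real_derivative ld_hess U K P L) (at 0)"
proof -
  let ?M = "K * U * K\<^sup>T"
  let ?F = "\<lambda>s. (K + s \<cdot>\<^sub>m P) * U * (K + s \<cdot>\<^sub>m P)\<^sup>T"
  let ?D = "P * U * K\<^sup>T + K * U * P\<^sup>T"
  let ?I = "\<lambda>s. (1 / det (?F s)) \<cdot>\<^sub>m adj_mat (?F s)"
  have F0: "?F 0 = ?M" by (simp only: add_zero_smult[OF K P])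
  have F: "?F s \<in> carrier_mat n n" for s
    by (rule mat_deriv_carrier(1)[OF congruence_deriv[OF K P U]])
  note nz' = nz[folded F0]
  note I = minv[OF F nz', unfolded F0]
  have I0: "(1 / det ?M) \<cdot>\<^sub>m adj_mat ?M = minv ?M" using minv_adj_mat[OF F nz'] unfolding F0 by simp
  have cF: "mat_deriv n n ?F ?D 0" by (rule congruence_deriv[OF K P U])
  have "mat_deriv n n ?I (- (minv ?M * ?D * minv ?M)) 0"
    using minv_deriv[OF cF nz'] unfolding F0 .
  from mat_deriv_mult_const_right[OF mat_deriv_mult_const_right[OF mat_deriv_mult[OF this mat_deriv_line[OF K P]] U]
      transpose_carrier_mat[THEN iffD2, OF L]]
  have "mat_deriv n n (\<lambda>s. ?I s * (K + s \<cdot>\<^sub>m P) * U * L\<^sup>T)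
     ((- (minv ?M * ?D * minv ?M) * K + minv ?M * P) * U * L\<^sup>T) 0"
    unfolding add_zero_smult[OF K P] I0 .
  from DERIV_cmult[OF Tr_deriv[OF this], of 2]
  have "((\<lambda>s. 2 * Tr (?I s * (K + s \<cdot>\<^sub>m P) * U * L\<^sup>T)) has_real_derivative
     2 * Tr ((- (minv ?M * ?D * minv ?M) * K + minv ?M * P) * U * L\<^sup>T)) (at 0)" .
  moreover have "(- (minv ?M * ?D * minv ?M) * K + minv ?M * P) * U * L\<^sup>T
      = minv ?M * P * U * L\<^sup>T - minv ?M * (K * U * P\<^sup>T + P * U * K\<^sup>T) * minv ?M * K * U * L\<^sup>T"
  proof -
    define V W where "V = minv ?M * ?D * minv ?M * K" and "W = minv ?M * P"
    have V: "V \<in> carrier_mat n N" and W: "W \<in> carrier_mat n N"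
      unfolding V_def W_def using I K P U by auto
    have "- (minv ?M * ?D * minv ?M) * K = - V"
      unfolding V_def using I K P U by (intro uminus_mult_left_mat) auto
    moreover have "- V + W = W - V" using V W by (intro eq_matI) auto
    moreover have "?D = K * U * P\<^sup>T + P * U * K\<^sup>T" using K P U by (intro comm_add_mat) auto
    ultimately show ?thesis
      using V W U L unfolding V_def[symmetric] W_def[symmetric]
      by (simp add: minus_mult_dim) (simp add: V_def W_def)
  qed
  ultimately have *: "((\<lambda>s. 2 * Tr (?I s * (K + s \<cdot>\<^sub>m P) * U * L\<^sup>T)) has_real_derivative ld_hess U K P L) (at 0)"
    by (simp only: ld_hess_def)
  \<comment> \<open>The adjugate curve agrees with \<open>minv\<close> only where the determinant is
    nonzero, hence only near 0.\<close>
  have ev: "\<forall>\<^sub>F s in nhds 0. 2 * Tr (?I s * (K + s \<cdot>\<^sub>m P) * U * L\<^sup>T) = ld_grad U (K + s \<cdot>\<^sub>m P) L"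
    using eventually_det_nonzero[OF cF nz']
  proof eventually_elim
    case (elim s)
    show ?case using minv_adj_mat[OF F elim] by (simp add: ld_grad_def)
  qed
  show ?thesis using DERIV_cong_ev[OF refl ev refl] * by blast
qed

subsection \<open>Schur complements and least squares\<close>

text \<open>Multiplying from the right by a unit block triangular matrix clears the upper right
  block without changing the determinant.\<close>

lemma det_schur_upper_left:
  assumes P: "P \<in> carrier_mat n n" "det P \<noteq> 0" and Q: "Q \<in> carrier_mat n m"
    and R: "R \<in> carrier_mat m n" and S: "(S :: real mat) \<in> carrier_mat m m"
  shows "det (four_block_mat P Q R S) = det P * det (S - R * (minv P * Q))"
proof -
  note I = minv[OF P]
  let ?V = "four_block_mat (1\<^sub>m n) (- (minv P * Q)) (0\<^sub>m m n) (1\<^sub>m m)"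
  have V: "?V \<in> carrier_mat (n + m) (n + m)" by simp
  have "four_block_mat P Q R S * ?V = four_block_mat P (0\<^sub>m n m) R (S - R * (minv P * Q))"
  proof -
    have "P * (- (minv P * Q)) = - Q"
      using I P Q by (subst uminus_mult_right_mat) (auto simp flip: mult_assoc_dim)
    moreover have "R * (- (minv P * Q)) = - (R * (minv P * Q))"
      using I R Q by (intro uminus_mult_right_mat) auto
    ultimately show ?thesis
      using I P Q R S by (subst mult_four_block_mat[of _ n n _ m _ m _ _ n _ m])
        (auto intro!: cong_four_block_mat eq_matI)
  qed
  then have "det (four_block_mat P Q R S) * det ?V = det P * det (S - R * (minv P * Q))"
    using P Q R S I by (subst det_mult[symmetric, OF _ V])
      (auto intro!: det_four_block_mat_upper_right_zero[of _ n _ m])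
  moreover have "det ?V = 1"
    using I Q by (subst det_four_block_mat_lower_left_zero[of _ n _ m]) auto
  ultimately show ?thesis by simp
qed

lemma det_schur_lower_right:
  assumes P: "P \<in> carrier_mat n n" and Q: "Q \<in> carrier_mat n m"
    and R: "R \<in> carrier_mat m n" and S: "(S :: real mat) \<in> carrier_mat m m" "det S \<noteq> 0"
  shows "det (four_block_mat P Q R S) = det S * det (P - Q * (minv S * R))"
proof -
  note I = minv[OF S]
  let ?V = "four_block_mat (1\<^sub>m n) (0\<^sub>m n m) (- (minv S * R)) (1\<^sub>m m)"
  have V: "?V \<in> carrier_mat (n + m) (n + m)" by simp
  have "four_block_mat P Q R S * ?V = four_block_mat (P - Q * (minv S * R)) Q (0\<^sub>m m n) S"
  proof -
    have "S * (- (minv S * R)) = - R"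
      using I S R by (subst uminus_mult_right_mat) (auto simp flip: mult_assoc_dim)
    moreover have "Q * (- (minv S * R)) = - (Q * (minv S * R))"
      using I R Q by (intro uminus_mult_right_mat) auto
    ultimately show ?thesis
      using I P Q R S by (subst mult_four_block_mat[of _ n n _ m _ m _ _ n _ m])
        (auto intro!: cong_four_block_mat eq_matI)
  qed
  then have "det (four_block_mat P Q R S) * det ?V = det S * det (P - Q * (minv S * R))"
    using P Q R S I by (subst det_mult[symmetric, OF _ V])
      (auto simp: mult.commute intro!: det_four_block_mat_lower_left_zero[of _ n _ m, THEN trans])
  moreover have "det ?V = 1"
    using I R by (subst det_four_block_mat_upper_right_zero[of _ n _ m]) auto
  ultimately show ?thesis by simp
qed

lemma row_independent_append_rows:
  assumes "row_independent (Y @\<^sub>r X)" "Y \<in> carrier_mat k t" "X \<in> carrier_mat N t"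
    and "C \<in> carrier_mat q k" "D \<in> carrier_mat q N" "C * Y + D * X = 0\<^sub>m q t"
  shows "C = 0\<^sub>m q k" "D = 0\<^sub>m q N"
proof -
  \<comment> \<open>The block row (C D) gets an empty bottom part because \<open>append_rows\<close>
    is itself a four-block matrix, with empty right blocks; block multiplication then
    applies.\<close>
  let ?E = "four_block_mat C D (0\<^sub>m 0 k) (0\<^sub>m 0 N)"
  have E: "?E \<in> carrier_mat q (k + N)"
    using four_block_carrier_mat[OF assms(4), of "0\<^sub>m 0 N" 0 N] by simp
  have "?E * (Y @\<^sub>r X) = four_block_mat (C * Y + D * X) (0\<^sub>m q 0) (0\<^sub>m 0 t) (0\<^sub>m 0 0)"
    unfolding append_rows_def using assms(2-5)
    by (subst mult_four_block_mat[of _ q k _ N _ 0 _ _ t _ 0]) (auto intro!: cong_four_block_mat)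
  also have "\<dots> = 0\<^sub>m q t" using assms(6) by (intro eq_matI) auto
  finally have "?E = 0\<^sub>m q (k + N)"
    using row_independentD[OF assms(1) carrier_append_rows[OF assms(2,3)] E] by simp
  then have *: "?E $$ (i, j) = 0" if "i < q" "j < k + N" for i j using that by simp
  show "C = 0\<^sub>m q k"
  proof (rule eq_matI)
    fix i j assume "i < dim_row (0\<^sub>m q k :: real mat)" "j < dim_col (0\<^sub>m q k :: real mat)"
    then show "C $$ (i, j) = 0\<^sub>m q k $$ (i, j)" using *[of i j] assms(4,5) by simp
  qed (use assms(4) in auto)
  show "D = 0\<^sub>m q N"
  proof (rule eq_matI)
    fix i j assume "i < dim_row (0\<^sub>m q N :: real mat)" "j < dim_col (0\<^sub>m q N :: real mat)"
    then show "D $$ (i, j) = 0\<^sub>m q N $$ (i, j)" using *[of i "k + j"] assms(4,5) by simp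
  qed (use assms(5) in auto)
qed

lemma row_independent_append_rows_upper:
  assumes "row_independent (Y @\<^sub>r X)" and Y: "Y \<in> carrier_mat k t" and X: "X \<in> carrier_mat N t"
  shows "row_independent Y"
proof (rule row_independentI[OF Y])
  fix q and C :: "real mat" assume C: "C \<in> carrier_mat q k" "C * Y = 0\<^sub>m q t"
  have "C * Y + 0\<^sub>m q N * X = 0\<^sub>m q t" using C X by simp
  then show "C = 0\<^sub>m q k"
    by (rule row_independent_append_rows(1)[OF assms C(1) zero_carrier_mat])
qed

text \<open>The least squares stage with \<open>kappa p d m G\<close> abstracted to any K with
  independent rows and the lagged data to any X; the Jordan structure enters only on
  instantiation.\<close>

locale regression =
  fixes k N n t :: nat and Y X K :: "real mat"
  assumes Y: "Y \<in> carrier_mat k t" and X: "X \<in> carrier_mat N t" and K: "K \<in> carrier_mat n N"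
    and data_indep: "row_independent (Y @\<^sub>r X)" and K_indep: "row_independent K"
begin

definition "Z = K * X"
abbreviation "S \<equiv> Z * Z\<^sup>T"
abbreviation "A \<equiv> X * X\<^sup>T - X * Y\<^sup>T * minv (Y * Y\<^sup>T) * Y * X\<^sup>T"

definition "H\<^sub>0 = Y * Z\<^sup>T * minv S"
definition "E H = Y - H * Z"

lemma Z: "Z \<in> carrier_mat n t"
  unfolding Z_def using K X by simp

lemma Y_indep: "row_independent Y"
  by (rule row_independent_append_rows_upper[OF data_indep Y X])

text \<open>A relation C Z = 0 is a relation between the rows of the data with coefficients 0 on Y
  and C K on X. It forces C K = 0, and the rows of K are independent.\<close>

lemma Z_indep: "row_independent Z"
proof (rule row_independentI[OF Z])
  fix q and C :: "real mat" assume C: "C \<in> carrier_mat q n" "C * Z = 0\<^sub>m q t"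
  have "C * K * X = 0\<^sub>m q t" using C K X by (simp add: Z_def mult_assoc_dim)
  then have "0\<^sub>m q k * Y + (C * K) * X = 0\<^sub>m q t" using Y by simp
  then have "C * K = 0\<^sub>m q N"
    by (rule row_independent_append_rows(2)[OF data_indep Y X zero_carrier_mat mult_carrier_mat[OF C(1) K]])
  then show "C = 0\<^sub>m q n" using row_independentD[OF K_indep K C(1)] by simp
qed

text \<open>C (Y - H K X) = 0 is a relation between the rows of the data whose coefficients on Y are
  C. So no choice of H makes the residual Gram matrix singular.\<close>

lemma E_indep:
  assumes "H \<in> carrier_mat k n"
  shows "row_independent (E H)"
proof (rule row_independentI)
  show "E H \<in> carrier_mat k t" unfolding E_def using assms Y Z by (intro minus_carrier_mat) auto
  fix q and C :: "real mat" assume C: "C \<in> carrier_mat q k" "C * E H = 0\<^sub>m q t"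
  have "C * Y + (- (C * H * K)) * X = C * E H"
  proof -
    have "(- (C * H * K)) * X = - (C * H * K * X)"
      using C assms K X by (intro uminus_mult_left_mat) auto
    moreover have "C * Y + - (C * H * K * X) = C * Y - C * H * K * X"
      using C assms K X Y by (intro minus_add_uminus_mat[symmetric]) auto
    moreover have "C * Y - C * H * K * X = C * E H"
      unfolding E_def Z_def using C assms K X Y by (simp add: mult_minus_dim mult_assoc_dim)
    ultimately show ?thesis by simp
  qed
  then have "C * Y + (- (C * H * K)) * X = 0\<^sub>m q t" using C(2) by simp
  moreover have "- (C * H * K) \<in> carrier_mat q N" using C(1) assms K by simp
  ultimately show "C = 0\<^sub>m q k"
    by (intro row_independent_append_rows(1)[OF data_indep Y X C(1)])
qed

lemma pd_S: "posdef n S"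
  by (rule posdef_gram[OF Z_indep Z])

lemma det_S_pos: "0 < det S"
  by (rule posdef_det_pos[OF pd_S])

lemma det_YY_pos: "0 < det (Y * Y\<^sup>T)"
  by (rule posdef_det_pos[OF posdef_gram[OF Y_indep Y]])

lemmas S_inv = minv[OF posdef_carrier[OF pd_S] posdef_det_nonzero[OF pd_S]]

lemmas YY_inv = minv[OF mult_carrier_mat[OF Y transpose_carrier_mat[THEN iffD2, OF Y]]
  less_imp_neq[OF det_YY_pos, symmetric]]

lemma H\<^sub>0: "H\<^sub>0 \<in> carrier_mat k n"
  unfolding H\<^sub>0_def using Y Z S_inv(1) by auto

lemma E_carrier: "H \<in> carrier_mat k n \<Longrightarrow> E H \<in> carrier_mat k t"
  unfolding E_def using Z Y by (intro minus_carrier_mat) auto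

lemma E_H\<^sub>0_orthogonal: "E H\<^sub>0 * Z\<^sup>T = 0\<^sub>m k n"
proof -
  have "H\<^sub>0 * Z * Z\<^sup>T = H\<^sub>0 * S"
    using H\<^sub>0 Z by (intro mult_assoc_dim) auto
  also have "\<dots> = Y * Z\<^sup>T * (minv S * S)"
    unfolding H\<^sub>0_def using Y Z S_inv by (intro mult_assoc_dim) auto
  also have "\<dots> = Y * Z\<^sup>T" unfolding S_inv(3) using Y Z by simp
  finally have "H\<^sub>0 * Z * Z\<^sup>T = Y * Z\<^sup>T" .
  then show ?thesis unfolding E_def using H\<^sub>0 Y Z by (subst minus_mult_dim) auto
qed

text \<open>Pythagoras: the residual of H is that of \<open>H\<^sub>0\<close> plus a combination of
  the rows of Z, and the cross terms vanish by the normal equations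
  \<open>E_H\<^sub>0_orthogonal\<close>.\<close>

lemma E_decomposition:
  assumes H: "H \<in> carrier_mat k n"
  shows "E H * (E H)\<^sup>T = E H\<^sub>0 * (E H\<^sub>0)\<^sup>T + ((H\<^sub>0 - H) * Z) * ((H\<^sub>0 - H) * Z)\<^sup>T"
proof -
  define D where "D = H\<^sub>0 - H"
  have D: "D \<in> carrier_mat k n" unfolding D_def using H by (rule minus_carrier_mat)
  note E0 = E_carrier[OF H\<^sub>0]
  have "D * Z = H\<^sub>0 * Z - H * Z" unfolding D_def using H H\<^sub>0 Z by (intro minus_mult_dim) auto
  then have EH: "E H = E H\<^sub>0 + D * Z"
    unfolding E_def using H H\<^sub>0 Z Y by (intro eq_matI) auto
  have "E H * (E H)\<^sup>T = E H\<^sub>0 * (E H\<^sub>0)\<^sup>T + D * Z * (E H\<^sub>0)\<^sup>T + (E H\<^sub>0 * (D * Z)\<^sup>T + D * Z * (D * Z)\<^sup>T)"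
    unfolding EH transpose_add[OF E0 mult_carrier_mat[OF D Z]] using E0 D Z
    by (subst mult_add_dim; (simp del: assoc_mult_mat add: add_mult_dim)?)
  moreover have "E H\<^sub>0 * (D * Z)\<^sup>T = 0\<^sub>m k k"
  proof -
    have "E H\<^sub>0 * (D * Z)\<^sup>T = E H\<^sub>0 * Z\<^sup>T * D\<^sup>T" using E0 D Z by (simp add: transpose_mult_dim mult_assoc_dim)
    then show ?thesis using E_H\<^sub>0_orthogonal D by simp
  qed
  moreover have "D * Z * (E H\<^sub>0)\<^sup>T = 0\<^sub>m k k"
  proof -
    have "D * Z * (E H\<^sub>0)\<^sup>T = (E H\<^sub>0 * (D * Z)\<^sup>T)\<^sup>T" using E0 D Z by (simp add: transpose_mult_dim)
    then show ?thesis using calculation(2) by simp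
  qed
  moreover have "0\<^sub>m k k + D * Z * (D * Z)\<^sup>T = D * Z * (D * Z)\<^sup>T"
    using D Z by (intro left_add_zero_mat[of _ k k]) auto
  ultimately show ?thesis
    unfolding D_def[symmetric] using right_add_zero_mat[of "E H\<^sub>0 * (E H\<^sub>0)\<^sup>T" k k] E0 by simp
qed

text \<open>One residual factor may be replaced by Y, since its fitted part is orthogonal to the
  other. The right side is bracketed as the Schur complement of S.\<close>

lemma E_H\<^sub>0_gram: "E H\<^sub>0 * (E H\<^sub>0)\<^sup>T = Y * Y\<^sup>T - Y * Z\<^sup>T * (minv S * (Z * Y\<^sup>T))"
proof -
  note E0 = E_carrier[OF H\<^sub>0]
  have "(E H\<^sub>0)\<^sup>T = Y\<^sup>T - Z\<^sup>T * H\<^sub>0\<^sup>T"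
    unfolding E_def using Y Z H\<^sub>0 by (subst transpose_minus_dim; simp add: transpose_mult_dim)
  then have "E H\<^sub>0 * (E H\<^sub>0)\<^sup>T = E H\<^sub>0 * Y\<^sup>T - E H\<^sub>0 * Z\<^sup>T * H\<^sub>0\<^sup>T"
    using E0 Y Z H\<^sub>0 by (simp add: mult_minus_dim mult_assoc_dim)
  also have "\<dots> = E H\<^sub>0 * Y\<^sup>T"
    unfolding E_H\<^sub>0_orthogonal using E0 Y H\<^sub>0 by (intro eq_matI) auto
  also have "\<dots> = Y * Y\<^sup>T - H\<^sub>0 * Z * Y\<^sup>T"
    unfolding E_def using Y Z H\<^sub>0 by (intro minus_mult_dim) auto
  also have "H\<^sub>0 * Z * Y\<^sup>T = Y * Z\<^sup>T * (minv S * (Z * Y\<^sup>T))"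
    unfolding H\<^sub>0_def using Y Z S_inv(1) by (simp add: mult_assoc_dim)
  finally show ?thesis .
qed

lemma pd_E_H\<^sub>0: "posdef k (E H\<^sub>0 * (E H\<^sub>0)\<^sup>T)"
  by (rule posdef_gram[OF E_indep[OF H\<^sub>0] E_carrier[OF H\<^sub>0]])

text \<open>Strict because Z has independent rows: different coefficients give different fitted
  values. Hence the minimizer is unique.\<close>

lemma residual_det_gt:
  assumes H: "H \<in> carrier_mat k n" "H \<noteq> H\<^sub>0"
  shows "det (E H\<^sub>0 * (E H\<^sub>0)\<^sup>T) < det (E H * (E H)\<^sup>T)"
  unfolding E_decomposition[OF H(1)]
proof (rule det_add_gram_gt[OF pd_E_H\<^sub>0])
  have D: "H\<^sub>0 - H \<in> carrier_mat k n" using H(1) by (rule minus_carrier_mat)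
  then show "(H\<^sub>0 - H) * Z \<in> carrier_mat k t" using Z by simp
  show "(H\<^sub>0 - H) * Z \<noteq> 0\<^sub>m k t"
  proof
    assume "(H\<^sub>0 - H) * Z = 0\<^sub>m k t"
    then have *: "H\<^sub>0 - H = 0\<^sub>m k n" by (rule row_independentD[OF Z_indep Z D])
    have "H = H\<^sub>0"
    proof (rule eq_matI)
      fix i j assume "i < dim_row H\<^sub>0" "j < dim_col H\<^sub>0"
      then show "H $$ (i, j) = H\<^sub>0 $$ (i, j)"
        using arg_cong[OF *, of "\<lambda>M. M $$ (i, j)"] H(1) H\<^sub>0 by simp
    qed (use H(1) H\<^sub>0 in auto)
    then show False using H(2) by simp
  qed
qed

text \<open>Both sides are the determinant of the Gram matrix of the stack of \<open>Y\<close> and \<open>Z\<close>.\<close>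

lemma det_profile: "det (Y * Y\<^sup>T) * det (K * A * K\<^sup>T) = det S * det (E H\<^sub>0 * (E H\<^sub>0)\<^sup>T)"
proof -
  \<comment> \<open>Congruence by K turns A into the Schur complement of Y Y' in the Gram matrix of
    the stack.\<close>
  have "K * A * K\<^sup>T = S - Z * Y\<^sup>T * (minv (Y * Y\<^sup>T) * (Y * Z\<^sup>T))"
  proof -
    define V where "V = X * Y\<^sup>T * minv (Y * Y\<^sup>T) * Y * X\<^sup>T"
    have V: "V \<in> carrier_mat N N" unfolding V_def using X Y YY_inv by auto
    have "K * (X * X\<^sup>T - V) * K\<^sup>T = K * (X * X\<^sup>T) * K\<^sup>T - K * V * K\<^sup>T"
      using K X V by (simp add: mult_minus_dim minus_mult_dim)
    moreover have "K * (X * X\<^sup>T) * K\<^sup>T = S" using K X by (simp add: Z_def mult_assoc_dim transpose_mult_dim)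
    moreover have "K * V * K\<^sup>T = Z * Y\<^sup>T * (minv (Y * Y\<^sup>T) * (Y * Z\<^sup>T))"
      unfolding V_def Z_def using K X Y YY_inv(1) by (simp add: mult_assoc_dim transpose_mult_dim)
    ultimately show ?thesis unfolding V_def by simp
  qed
  then have "det (Y * Y\<^sup>T) * det (K * A * K\<^sup>T)
      = det (four_block_mat (Y * Y\<^sup>T) (Y * Z\<^sup>T) (Z * Y\<^sup>T) S)"
    using Y Z det_YY_pos by (subst det_schur_upper_left[of _ k _ n]) auto
  also have "\<dots> = det S * det (E H\<^sub>0 * (E H\<^sub>0)\<^sup>T)"
    unfolding E_H\<^sub>0_gram using Y Z det_S_pos by (subst det_schur_lower_right[of _ k _ n]) auto
  finally show ?thesis .
qed

text \<open>The other three determinants in \<open>det_profile\<close> are positive, so the fourth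
  is.\<close>

lemma det_KAK_pos: "0 < det (K * A * K\<^sup>T)"
  using det_profile det_YY_pos det_S_pos posdef_det_pos[OF pd_E_H\<^sub>0]
  by (metis mult_pos_pos zero_less_mult_pos)

end

subsection \<open>Stacks and block diagonal matrices\<close>

lemma index_append_rows:
  assumes "i < dim_row A + dim_row B" "j < dim_col A"
  shows "(A @\<^sub>r B) $$ (i, j) = (if i < dim_row A then A $$ (i, j) else B $$ (i - dim_row A, j))"
  using assms by (simp add: append_rows_def)

lemma dim_append_rows: "dim_row (A @\<^sub>r B) = dim_row A + dim_row B" "dim_col (A @\<^sub>r B) = dim_col A"
  by (simp_all add: append_rows_def)

lemma vstack_Nil: "vstack nc [] = 0\<^sub>m 0 nc"
  by (simp add: vstack_def)

lemma vstack_Cons: "vstack nc (A # As) = A @\<^sub>r vstack nc As"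
  by (simp add: vstack_def)

lemma dim_col_vstack: "(\<And>A. A \<in> set As \<Longrightarrow> dim_col A = nc) \<Longrightarrow> dim_col (vstack nc As) = nc"
  by (cases As) (simp_all add: vstack_Nil vstack_Cons dim_append_rows)

lemma vstack_carrier:
  "(\<And>r. r \<in> set rs \<Longrightarrow> A r \<in> carrier_mat (a r) nc) \<Longrightarrow>
     vstack nc (map A rs) \<in> carrier_mat (sum_list (map a rs)) nc"
  by (induction rs) (auto simp: vstack_Nil vstack_Cons)

lemma index_vstack_uniform:
  assumes "\<And>A. A \<in> set As \<Longrightarrow> A \<in> carrier_mat h nc" "a < length As * h" "c < nc"
  shows "vstack nc As $$ (a, c) = (As ! (a div h)) $$ (a mod h, c)"
  using assms
proof (induction As arbitrary: a)
  case (Cons A As)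
  have h: "0 < h" using Cons.prems(2) by (cases h) auto
  have A: "A \<in> carrier_mat h nc" using Cons.prems(1) by simp
  have "dim_row (vstack nc As) = length As * h"
    using vstack_carrier[of As id "\<lambda>_. h" nc] Cons.prems(1) by (simp add: sum_list_triv)
  then have i: "vstack nc (A # As) $$ (a, c) = (if a < h then A $$ (a, c) else vstack nc As $$ (a - h, c))"
    unfolding vstack_Cons using A Cons.prems by (subst index_append_rows) auto
  show ?case
  proof (cases "a < h")
    case False
    then have "a div h = Suc ((a - h) div h)" "a mod h = (a - h) mod h"
      using h by (auto simp: le_div_geq le_mod_geq)
    moreover have "vstack nc As $$ (a - h, c) = (As ! ((a - h) div h)) $$ ((a - h) mod h, c)"
      using Cons.prems False by (intro Cons.IH) auto
    ultimately show ?thesis using i False by simp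
  qed (use i in simp)
qed simp

lemma hstack_carrier:
  assumes "\<And>A. A \<in> set As \<Longrightarrow> A \<in> carrier_mat nr w"
  shows "hstack nr As \<in> carrier_mat nr (length As * w)"
  using vstack_carrier[of As transpose_mat "\<lambda>_. w" nr] assms
  by (simp add: hstack_def sum_list_triv)

lemma index_hstack_uniform:
  assumes "\<And>A. A \<in> set As \<Longrightarrow> A \<in> carrier_mat nr w" "i < nr" "c < length As * w"
  shows "hstack nr As $$ (i, c) = (As ! (c div w)) $$ (i, c mod w)"
proof -
  have V: "vstack nr (map transpose_mat As) \<in> carrier_mat (length As * w) nr"
    using vstack_carrier[of As transpose_mat "\<lambda>_. w" nr] assms(1) by (simp add: sum_list_triv)
  have w: "0 < w" using assms(3) by (cases w) auto
  have q: "c div w < length As" using assms(3) by (rule less_mult_imp_div_less)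
  then have "As ! (c div w) \<in> carrier_mat nr w" by (intro assms(1) nth_mem)
  moreover have "vstack nr (map transpose_mat As) $$ (c, i) = (map transpose_mat As ! (c div w)) $$ (c mod w, i)"
    using assms by (intro index_vstack_uniform[of _ w]) auto
  ultimately show ?thesis unfolding hstack_def using V assms(2,3) q w by simp
qed

lemma append_rows_assoc:
  assumes "dim_col A = nc" "dim_col B = nc" "dim_col C = nc"
  shows "(A @\<^sub>r B) @\<^sub>r C = A @\<^sub>r (B @\<^sub>r C)"
  using assms by (intro eq_matI) (auto simp: index_append_rows dim_append_rows)

lemma vstack_append:
  assumes "\<And>A. A \<in> set (As @ Bs) \<Longrightarrow> dim_col A = nc"
  shows "vstack nc (As @ Bs) = vstack nc As @\<^sub>r vstack nc Bs"
  using assms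
proof (induction As)
  case Nil
  then show ?case using dim_col_vstack[of Bs nc]
    by (intro eq_matI) (auto simp: vstack_Nil index_append_rows dim_append_rows)
next
  case (Cons A As)
  then show ?case using dim_col_vstack[of As nc] dim_col_vstack[of Bs nc]
    by (simp add: vstack_Cons append_rows_assoc[of _ nc])
qed

lemma vstack_concat:
  assumes "\<And>As A. As \<in> set Ass \<Longrightarrow> A \<in> set As \<Longrightarrow> dim_col A = nc"
  shows "vstack nc (concat Ass) = vstack nc (map (vstack nc) Ass)"
  using assms
proof (induction Ass)
  case (Cons As Ass)
  have "vstack nc (concat (As # Ass)) = vstack nc As @\<^sub>r vstack nc (concat Ass)"
    using Cons.prems by (simp only: concat.simps) (rule vstack_append, auto)
  also have "vstack nc (concat Ass) = vstack nc (map (vstack nc) Ass)"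
    using Cons.prems by (intro Cons.IH) auto
  finally show ?case by (simp add: vstack_Cons)
qed (simp add: vstack_Nil)

text \<open>The widths and the columns may differ because a column of \<open>kappa\<close> is
  compared with a column of a power of F times G, which is p times narrower.\<close>

lemma index_vstack_cong:
  assumes "\<And>r. r \<in> set rs \<Longrightarrow> A r \<in> carrier_mat (a r) nc \<and> B r \<in> carrier_mat (a r) nc'"
    and "\<And>r i. r \<in> set rs \<Longrightarrow> i < a r \<Longrightarrow> A r $$ (i, c) = B r $$ (i, c')"
    and "i < sum_list (map a rs)" "c < nc" "c' < nc'"
  shows "vstack nc (map A rs) $$ (i, c) = vstack nc' (map B rs) $$ (i, c')"
  using assms
proof (induction rs arbitrary: i)
  case (Cons r rs)
  have AB: "A r \<in> carrier_mat (a r) nc" "B r \<in> carrier_mat (a r) nc'" using Cons.prems(1) by auto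
  have V: "vstack nc (map A rs) \<in> carrier_mat (sum_list (map a rs)) nc"
      "vstack nc' (map B rs) \<in> carrier_mat (sum_list (map a rs)) nc'"
    using Cons.prems(1) by (auto intro!: vstack_carrier)
  show ?case
  proof (cases "i < a r")
    case True
    then show ?thesis using AB V Cons.prems(2-5) by (simp add: vstack_Cons index_append_rows)
  next
    case False
    then have "vstack nc (map A rs) $$ (i - a r, c) = vstack nc' (map B rs) $$ (i - a r, c')"
      using Cons.prems by (intro Cons.IH) auto
    then show ?thesis using False AB V Cons.prems(3-5) by (simp add: vstack_Cons index_append_rows)
  qed
qed simp

lemma diag_block_mat_Cons:
  "diag_block_mat (A # As) = four_block_mat A (0\<^sub>m (dim_row A) (dim_col (diag_block_mat As)))
     (0\<^sub>m (dim_row (diag_block_mat As)) (dim_col A)) (diag_block_mat As)"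
  by (simp add: Let_def)

lemma diag_block_mat_carrier:
  "(\<And>r. r \<in> set rs \<Longrightarrow> A r \<in> carrier_mat (a r) (b r)) \<Longrightarrow>
     diag_block_mat (map A rs) \<in> carrier_mat (sum_list (map a rs)) (sum_list (map b rs))"
  by (induction rs) (auto simp: diag_block_mat_Cons simp del: diag_block_mat.simps(2))

lemma diag_block_mat_mult_vstack:
  fixes A :: "'r \<Rightarrow> real mat"
  assumes "\<And>r. r \<in> set rs \<Longrightarrow> A r \<in> carrier_mat (a r) (b r) \<and> B r \<in> carrier_mat (b r) nc"
  shows "diag_block_mat (map A rs) * vstack nc (map B rs) = vstack nc (map (\<lambda>r. A r * B r) rs)"
  using assms
proof (induction rs)
  case (Cons r rs)
  have AB: "A r \<in> carrier_mat (a r) (b r)" "B r \<in> carrier_mat (b r) nc" using Cons.prems by auto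
  have D: "diag_block_mat (map A rs) \<in> carrier_mat (sum_list (map a rs)) (sum_list (map b rs))"
    using Cons.prems by (intro diag_block_mat_carrier) auto
  have V: "vstack nc (map B rs) \<in> carrier_mat (sum_list (map b rs)) nc"
    using Cons.prems by (intro vstack_carrier) auto
  have "diag_block_mat (map A (r # rs)) * vstack nc (map B (r # rs))
      = (A r * B r) @\<^sub>r (diag_block_mat (map A rs) * vstack nc (map B rs))"
    unfolding list.map diag_block_mat_Cons vstack_Cons append_rows_def using AB D V
    by (subst mult_four_block_mat[OF AB(1) _ _ D AB(2) _ V]) (auto intro!: cong_four_block_mat)
  then show ?case using Cons.IH Cons.prems by (simp add: vstack_Cons)
qed (simp add: vstack_Nil)

lemma diag_block_mat_mult:
  fixes A :: "'r \<Rightarrow> real mat"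
  assumes "\<And>r. r \<in> set rs \<Longrightarrow> A r \<in> carrier_mat (a r) (b r) \<and> B r \<in> carrier_mat (b r) (c r)"
  shows "diag_block_mat (map A rs) * diag_block_mat (map B rs) = diag_block_mat (map (\<lambda>r. A r * B r) rs)"
  using assms
proof (induction rs)
  case (Cons r rs)
  have AB: "A r \<in> carrier_mat (a r) (b r)" "B r \<in> carrier_mat (b r) (c r)" using Cons.prems by auto
  have D: "diag_block_mat (map A rs) \<in> carrier_mat (sum_list (map a rs)) (sum_list (map b rs))"
      "diag_block_mat (map B rs) \<in> carrier_mat (sum_list (map b rs)) (sum_list (map c rs))"
    using Cons.prems by (auto intro!: diag_block_mat_carrier)
  have IH: "diag_block_mat (map A rs) * diag_block_mat (map B rs) = diag_block_mat (map (\<lambda>r. A r * B r) rs)"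
    using Cons by simp
  show ?case
    unfolding list.map diag_block_mat_Cons IH[symmetric] using AB D
    by (subst mult_four_block_mat[OF AB(1) _ _ D(1) AB(2) _ _ D(2)]) (auto intro!: cong_four_block_mat)
qed simp

lemma diag_block_mat_add:
  fixes A :: "'r \<Rightarrow> real mat"
  assumes "\<And>r. r \<in> set rs \<Longrightarrow> A r \<in> carrier_mat (a r) (b r) \<and> B r \<in> carrier_mat (a r) (b r)"
  shows "diag_block_mat (map A rs) + diag_block_mat (map B rs) = diag_block_mat (map (\<lambda>r. A r + B r) rs)"
  using assms
proof (induction rs)
  case (Cons r rs)
  have AB: "A r \<in> carrier_mat (a r) (b r)" "B r \<in> carrier_mat (a r) (b r)" using Cons.prems by auto
  have D: "diag_block_mat (map A rs) \<in> carrier_mat (sum_list (map a rs)) (sum_list (map b rs))"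
      "diag_block_mat (map B rs) \<in> carrier_mat (sum_list (map a rs)) (sum_list (map b rs))"
    using Cons.prems by (auto intro!: diag_block_mat_carrier)
  have IH: "diag_block_mat (map A rs) + diag_block_mat (map B rs) = diag_block_mat (map (\<lambda>r. A r + B r) rs)"
    using Cons by simp
  show ?case
    unfolding list.map diag_block_mat_Cons IH[symmetric] using AB D
    by (intro eq_matI) auto
qed (auto intro!: eq_matI)

lemma diag_block_mat_transpose: "(diag_block_mat (map A rs))\<^sup>T = diag_block_mat (map (\<lambda>r. (A r)\<^sup>T) rs)"
proof (induction rs)
  case (Cons r rs)
  show ?case unfolding list.map diag_block_mat_Cons Cons.IH[symmetric] by (intro eq_matI) auto
qed (auto intro!: eq_matI)

lemma diag_block_mat_one: "diag_block_mat (map (\<lambda>r. 1\<^sub>m (a r)) rs) = 1\<^sub>m (sum_list (map a rs))"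
  using diag_block_one_mat[of "map (\<lambda>r. 1\<^sub>m (a r)) rs"] by (simp add: o_def)

lemma diag_block_mat_zero:
  "diag_block_mat (map (\<lambda>r. 0\<^sub>m (a r) (b r)) rs) = 0\<^sub>m (sum_list (map a rs)) (sum_list (map b rs))"
proof (induction rs)
  case (Cons r rs)
  show ?case unfolding list.map diag_block_mat_Cons Cons.IH by (intro eq_matI) auto
qed simp

subsection \<open>The shift structure of the Jordan blocks\<close>

text \<open>Rectangular so that one notion covers the Jordan block (square, shift e) and the
  selector of its last sub-block (e rows, shift (r - 1) e).\<close>

definition shift_mat :: "nat \<Rightarrow> nat \<Rightarrow> nat \<Rightarrow> real mat" where
  "shift_mat n m s = mat n m (\<lambda>(i, j). if j = i + s then 1 else 0)"

lemma shift_mat_carrier: "shift_mat n m s \<in> carrier_mat n m"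
  by (simp add: shift_mat_def)

lemma shift_mat_mult:
  assumes "M \<in> carrier_mat m w"
  shows "shift_mat n m s * M = mat n w (\<lambda>(i, c). if i + s < m then M $$ (i + s, c) else 0)"
proof (rule eq_matI)
  fix i c
  assume "i < dim_row (mat n w (\<lambda>(i, c). if i + s < m then M $$ (i + s, c) else 0))"
    "c < dim_col (mat n w (\<lambda>(i, c). if i + s < m then M $$ (i + s, c) else 0))"
  then have ic: "i < n" "c < w" by auto
  have "(shift_mat n m s * M) $$ (i, c) = (\<Sum>l<m. (if l = i + s then 1 else 0) * M $$ (l, c))"
    using ic assms by (subst index_mult_mat_sum) (auto simp: shift_mat_def)
  also have "\<dots> = (\<Sum>l<m. if l = i + s then M $$ (l, c) else 0)"
    by (intro sum.cong) auto
  also have "\<dots> = (if i + s < m then M $$ (i + s, c) else 0)"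
    by (simp add: sum.delta)
  finally show "(shift_mat n m s * M) $$ (i, c)
      = mat n w (\<lambda>(i, c). if i + s < m then M $$ (i + s, c) else 0) $$ (i, c)"
    using ic by simp
qed (use assms in \<open>auto simp: shift_mat_def\<close>)

text \<open>One step to the next sub-block at an unchanged offset inside it is a step of e
  positions.\<close>

lemma K_mat_eq_shift: "K_mat r e = shift_mat (r * e) (r * e) e"
proof (rule eq_matI)
  fix i j assume "i < dim_row (shift_mat (r * e) (r * e) e)" "j < dim_col (shift_mat (r * e) (r * e) e)"
  then have ij: "i < r * e" "j < r * e" by (auto simp: shift_mat_def)
  then have e: "0 < e" by (cases e) auto
  have div: "i div e < r" "j div e < r" using ij by (auto intro: less_mult_imp_div_less)
  have "(j div e = i div e + 1 \<and> i mod e = j mod e) \<longleftrightarrow> j = i + e"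
  proof
    assume *: "j div e = i div e + 1 \<and> i mod e = j mod e"
    have "j = (j div e) * e + j mod e" by simp
    also have "\<dots> = (i div e) * e + i mod e + e" using * by (simp add: algebra_simps)
    finally show "j = i + e" by simp
  qed (use e in simp)
  then show "K_mat r e $$ (i, j) = shift_mat (r * e) (r * e) e $$ (i, j)"
    using ij div e by (auto simp: K_mat_def kron_def J_mat_def shift_mat_def)
qed (auto simp: K_mat_def kron_def J_mat_def shift_mat_def)

lemma K_mat_carrier: "K_mat r e \<in> carrier_mat (r * e) (r * e)"
  by (simp add: K_mat_eq_shift shift_mat_carrier)

lemma K_mat_pow_mult:
  assumes "M \<in> carrier_mat (r * e) w"
  shows "K_mat r e ^\<^sub>m j * M = mat (r * e) w (\<lambda>(i, c). if i + j * e < r * e then M $$ (i + j * e, c) else 0)"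
  using assms
proof (induction j arbitrary: M)
  case 0
  then have "K_mat r e ^\<^sub>m 0 * M = M" using K_mat_carrier[of r e] by simp
  then show ?case using 0 by (intro eq_matI) auto
next
  case (Suc j)
  let ?N = "K_mat r e * M"
  have N: "?N \<in> carrier_mat (r * e) w" using Suc.prems K_mat_carrier[of r e] by simp
  have "K_mat r e ^\<^sub>m Suc j * M = K_mat r e ^\<^sub>m j * ?N"
    using Suc.prems K_mat_carrier[of r e] by (simp add: assoc_mult_mat[of _ "r * e" "r * e" _ "r * e" _ w])
  also have "\<dots> = mat (r * e) w (\<lambda>(i, c). if i + j * e < r * e then ?N $$ (i + j * e, c) else 0)"
    by (rule Suc.IH[OF N])
  also have "\<dots> = mat (r * e) w (\<lambda>(i, c). if i + Suc j * e < r * e then M $$ (i + Suc j * e, c) else 0)"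
    unfolding K_mat_eq_shift shift_mat_mult[OF Suc.prems]
    by (intro eq_matI) (auto simp: algebra_simps)
  finally show ?case .
qed

text \<open>The second product projects onto the first r - 1 sub-blocks and the first product onto
  the last one.\<close>

lemma shift_mat_complement:
  assumes "0 < r"
  shows "(shift_mat e (r * e) ((r - 1) * e))\<^sup>T * shift_mat e (r * e) ((r - 1) * e)
    + K_mat r e * (K_mat r e)\<^sup>T = 1\<^sub>m (r * e)" (is "?S\<^sup>T * ?S + _ = _")
proof (rule eq_matI)
  obtain r' where r: "r = Suc r'" using assms by (cases r) auto
  note S = shift_mat_carrier[of e "r * e" "(r - 1) * e"] and K = K_mat_carrier[of r e]
  fix i j assume "i < dim_row (1\<^sub>m (r * e) :: real mat)" "j < dim_col (1\<^sub>m (r * e) :: real mat)"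
  then have ij: "i < r * e" "j < r * e" by auto
  have "(?S\<^sup>T * ?S) $$ (i, j) = (\<Sum>l<e. ?S\<^sup>T $$ (i, l) * ?S $$ (l, j))"
    using ij S by (subst index_mult_mat_sum) (auto simp: shift_mat_def)
  also have "\<dots> = (\<Sum>l<e. if l = i - r' * e then (if r' * e \<le> i \<and> i = j then 1 else 0) else 0)"
    using ij by (intro sum.cong) (auto simp: shift_mat_def r)
  also have "\<dots> = (if r' * e \<le> i \<and> i = j then 1 else 0)"
    using ij by (auto simp: sum.delta r)
  finally have 1: "(?S\<^sup>T * ?S) $$ (i, j) = (if r' * e \<le> i \<and> i = j then 1 else 0)" .
  have "(K_mat r e * (K_mat r e)\<^sup>T) $$ (i, j)
      = mat (r * e) (r * e) (\<lambda>(i, c). if i + e < r * e then (K_mat r e)\<^sup>T $$ (i + e, c) else 0) $$ (i, j)"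
    using K shift_mat_mult[of "(K_mat r e)\<^sup>T" "r * e" "r * e" "r * e" e] by (simp add: K_mat_eq_shift)
  also have "\<dots> = (if i < r' * e \<and> i = j then 1 else 0)"
    using ij by (auto simp: K_mat_eq_shift shift_mat_def r)
  finally have 2: "(K_mat r e * (K_mat r e)\<^sup>T) $$ (i, j) = (if i < r' * e \<and> i = j then 1 else 0)" .
  show "(?S\<^sup>T * ?S + K_mat r e * (K_mat r e)\<^sup>T) $$ (i, j) = 1\<^sub>m (r * e) $$ (i, j)"
    using ij K 1 2 by (subst index_add_mat) auto
qed (use shift_mat_carrier[of e "r * e" "(r - 1) * e"] K_mat_carrier[of r e] in auto)

section \<open>Row groups and powers of F\<close>

text \<open>Cuts M into the row ranges of the diagonal blocks of F, so that F acts on each group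
  separately.\<close>

definition row_group :: "nat \<Rightarrow> (nat \<Rightarrow> nat) \<Rightarrow> nat \<Rightarrow> real mat \<Rightarrow> nat \<Rightarrow> real mat" where
  "row_group p d w M r = mat (r * d r) w (\<lambda>(a, c). M $$ ((\<Sum>q=Suc r..p. q * d q) + a, c))"

lemma row_group_carrier: "row_group p d w M r \<in> carrier_mat (r * d r) w"
  by (simp add: row_group_def)

lemma sum_list_rev_upt: "sum_list (map f (rev [1..<Suc p])) = (\<Sum>i=1..p. f i :: nat)"
  by (simp only: rev_map[symmetric] sum_list_rev interv_sum_list_conv_sum_set_nat
      set_upt atLeastLessThanSuc_atLeastAtMost)

lemma n_min_sum_list: "sum_list (map (\<lambda>r. r * d r) (rev [1..<Suc p])) = n_min p d"
  by (simp only: sum_list_rev_upt n_min_def)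

text \<open>Generalized to the bottom n groups for the induction: the list for n is a tail of the
  list for p, while the offsets still count from the top of M.\<close>

lemma vstack_row_group_tail:
  assumes "n \<le> p"
  shows "vstack w (map (row_group p d w M) (rev [1..<Suc n]))
    = mat (n_min n d) w (\<lambda>(a, c). M $$ ((\<Sum>q=Suc n..p. q * d q) + a, c))"
  using assms
proof (induction n)
  case 0
  then show ?case by (intro eq_matI) (auto simp: vstack_Nil n_min_def)
next
  case (Suc n)
  have off: "(\<Sum>q=Suc n..p. q * d q) = Suc n * d (Suc n) + (\<Sum>q=Suc (Suc n)..p. q * d q)"
    using Suc.prems by (rule sum.atLeast_Suc_atMost)
  have "rev [1..<Suc (Suc n)] = Suc n # rev [1..<Suc n]" by simp
  then have "vstack w (map (row_group p d w M) (rev [1..<Suc (Suc n)]))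
      = row_group p d w M (Suc n) @\<^sub>r mat (n_min n d) w (\<lambda>(a, c). M $$ ((\<Sum>q=Suc n..p. q * d q) + a, c))"
    using Suc by (simp only: list.map vstack_Cons Suc_leD)
  also have "\<dots> = mat (n_min (Suc n) d) w (\<lambda>(a, c). M $$ ((\<Sum>q=Suc (Suc n)..p. q * d q) + a, c))"
    unfolding off
    by (intro eq_matI) (auto simp: index_append_rows dim_append_rows row_group_def n_min_def add_ac)
  finally show ?case .
qed

lemma vstack_row_group:
  assumes "M \<in> carrier_mat (n_min p d) w"
  shows "vstack w (map (row_group p d w M) (rev [1..<Suc p])) = M"
  unfolding vstack_row_group_tail[OF order_refl] using assms by (intro eq_matI) auto

lemma F_mat_carrier: "F_mat p d \<in> carrier_mat (n_min p d) (n_min p d)"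
  using diag_block_mat_carrier[of "rev [1..<Suc p]" "\<lambda>r. K_mat r (d r)" "\<lambda>r. r * d r" "\<lambda>r. r * d r"]
    K_mat_carrier by (simp only: n_min_sum_list F_mat_def)

lemma F_mat_pow: "F_mat p d ^\<^sub>m j = diag_block_mat (map (\<lambda>r. K_mat r (d r) ^\<^sub>m j) (rev [1..<Suc p]))"
proof -
  have "Ball (set (map (\<lambda>r. K_mat r (d r)) (rev [1..<Suc p]))) square_mat"
    by (auto simp: carrier_matD[OF K_mat_carrier] simp del: upt_Suc)
  from diag_block_pow_mat[OF this] show ?thesis by (simp only: F_mat_def map_map o_def)
qed

lemma F_mat_pow_carrier: "F_mat p d ^\<^sub>m j \<in> carrier_mat (n_min p d) (n_min p d)"
  by (rule pow_carrier_mat[OF F_mat_carrier])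

lemma F_mat_pow_mult:
  assumes "M \<in> carrier_mat (n_min p d) w"
  shows "F_mat p d ^\<^sub>m j * M
    = vstack w (map (\<lambda>r. K_mat r (d r) ^\<^sub>m j * row_group p d w M r) (rev [1..<Suc p]))"
proof -
  have "F_mat p d ^\<^sub>m j * vstack w (map (row_group p d w M) (rev [1..<Suc p]))
     = vstack w (map (\<lambda>r. K_mat r (d r) ^\<^sub>m j * row_group p d w M r) (rev [1..<Suc p]))"
    unfolding F_mat_pow using pow_carrier_mat[OF K_mat_carrier] row_group_carrier
    by (intro diag_block_mat_mult_vstack[where a = "\<lambda>r. r * d r" and b = "\<lambda>r. r * d r"]) auto
  then show ?thesis unfolding vstack_row_group[OF assms] .
qed

lemma F_mat_nilpotent: "F_mat p d ^\<^sub>m p = 0\<^sub>m (n_min p d) (n_min p d)"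
proof -
  have "K_mat r (d r) ^\<^sub>m p = 0\<^sub>m (r * d r) (r * d r)" if "r \<in> set (rev [1..<Suc p])" for r
  proof -
    \<comment> \<open>Shifting by p sub-blocks leaves a group that has only r \<le> p of
      them.\<close>
    have "r * d r \<le> p * d r" using that by (intro mult_right_mono) auto
    then have "\<not> i + p * d r < r * d r" for i by linarith
    then have "mat (r * d r) (r * d r) (\<lambda>(i, c). if i + p * d r < r * d r then 1\<^sub>m (r * d r) $$ (i + p * d r, c) else 0)
        = (0\<^sub>m (r * d r) (r * d r) :: real mat)" by (intro eq_matI) auto
    then have "K_mat r (d r) ^\<^sub>m p * 1\<^sub>m (r * d r) = 0\<^sub>m (r * d r) (r * d r)"
      by (simp only: K_mat_pow_mult[OF one_carrier_mat])
    then show ?thesis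
      unfolding right_mult_one_mat[OF pow_carrier_mat[OF K_mat_carrier[of r "d r"]]] .
  qed
  then have "map (\<lambda>r. K_mat r (d r) ^\<^sub>m p) (rev [1..<Suc p])
      = map (\<lambda>r. 0\<^sub>m (r * d r) (r * d r)) (rev [1..<Suc p])" by (intro map_cong refl)
  then have "F_mat p d ^\<^sub>m p = diag_block_mat (map (\<lambda>r. 0\<^sub>m (r * d r) (r * d r)) (rev [1..<Suc p]))"
    by (simp only: F_mat_pow)
  then show ?thesis unfolding diag_block_mat_zero by (simp only: n_min_sum_list)
qed

subsection \<open>The matrix \<open>kappa\<close>\<close>

lemma G_block_carrier: "G_block p d m G r j \<in> carrier_mat (d r) m"
  by (simp add: G_block_def)

definition kappa_row :: "nat \<Rightarrow> (nat \<Rightarrow> nat) \<Rightarrow> nat \<Rightarrow> real mat \<Rightarrow> nat \<Rightarrow> nat \<Rightarrow> real mat" where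
  "kappa_row p d m G r l = hstack (d r)
     (map (\<lambda>i. if i \<le> r - l then G_block p d m G r (r - l - i) else 0\<^sub>m (d r) m) (rev [1..<Suc p]))"

lemma kappa_row_carrier: "kappa_row p d m G r l \<in> carrier_mat (d r) (p * m)"
proof -
  let ?L = "map (\<lambda>i. if i \<le> r - l then G_block p d m G r (r - l - i) else 0\<^sub>m (d r) m) (rev [1..<Suc p])"
  have "hstack (d r) ?L \<in> carrier_mat (d r) (length ?L * m)"
    by (rule hstack_carrier) (auto simp: G_block_carrier simp del: upt_Suc)
  moreover have "length ?L = p" by (simp del: upt_Suc)
  ultimately show ?thesis by (simp only: kappa_row_def)
qed

text \<open>Block columns run from p down to 1, so column c belongs to lag p - c div m.\<close>

lemma index_kappa_row:
  assumes "i < d r" "c < p * m"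
  shows "kappa_row p d m G r l $$ (i, c)
    = (if p - c div m \<le> r - l then G_block p d m G r (r - l - (p - c div m)) $$ (i, c mod m) else 0)"
proof -
  let ?f = "\<lambda>i. if i \<le> r - l then G_block p d m G r (r - l - i) else 0\<^sub>m (d r) m"
  have m: "0 < m" using assms(2) by (cases m) auto
  have q: "c div m < p" using assms(2) by (rule less_mult_imp_div_less)
  have "kappa_row p d m G r l $$ (i, c) = (map ?f (rev [1..<Suc p]) ! (c div m)) $$ (i, c mod m)"
    unfolding kappa_row_def using assms G_block_carrier 
    by (intro index_hstack_uniform) (auto simp del: upt_Suc)
  also have "map ?f (rev [1..<Suc p]) ! (c div m) = ?f (p - c div m)"
  proof -
    have "rev [1..<Suc p] ! (c div m) = p - c div m"
      using q by (subst rev_nth) (auto simp: Suc_diff_Suc simp del: upt_Suc)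
    then show ?thesis using q by (subst nth_map) (auto simp del: upt_Suc)
  qed
  finally show ?thesis using assms(1) m by auto
qed

definition kappa_group :: "nat \<Rightarrow> (nat \<Rightarrow> nat) \<Rightarrow> nat \<Rightarrow> real mat \<Rightarrow> nat \<Rightarrow> real mat" where
  "kappa_group p d m G r = vstack (p * m) (map (kappa_row p d m G r) [0..<r])"

lemma kappa_group_carrier: "kappa_group p d m G r \<in> carrier_mat (r * d r) (p * m)"
  unfolding kappa_group_def
  using vstack_carrier[of "[0..<r]" "kappa_row p d m G r" "\<lambda>_. d r" "p * m"] kappa_row_carrier
  by (simp add: sum_list_triv)

lemma kappa_eq_vstack: "kappa p d m G = vstack (p * m) (map (kappa_group p d m G) (rev [1..<Suc p]))"
proof -
  have "kappa p d m G = vstack (p * m) (concat (map (\<lambda>r. map (kappa_row p d m G r) [0..<r]) (rev [1..<Suc p])))"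
    by (simp only: kappa_def kappa_row_def[abs_def])
  also have "\<dots> = vstack (p * m) (map (vstack (p * m)) (map (\<lambda>r. map (kappa_row p d m G r) [0..<r]) (rev [1..<Suc p])))"
    by (intro vstack_concat) (auto simp: carrier_matD(2)[OF kappa_row_carrier] simp del: upt_Suc)
  finally show ?thesis by (simp only: map_map o_def kappa_group_def[abs_def])
qed

lemma kappa_carrier: "kappa p d m G \<in> carrier_mat (n_min p d) (p * m)"
  unfolding kappa_eq_vstack n_min_sum_list[symmetric]
  by (intro vstack_carrier kappa_group_carrier)

text \<open>In group r, sub-block s from the top is G_{r,r-1-s}. Shifting sub-block l by i - 1 reads
  s = l + i - 1, which is G_{r,r-l-i}, or runs past the group exactly when i > r - l.\<close>

lemma index_kappa_group:
  assumes "a < r * d r" "c < p * m"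
  shows "kappa_group p d m G r $$ (a, c)
    = (K_mat r (d r) ^\<^sub>m (p - c div m - 1) * row_group p d m G r) $$ (a, c mod m)"
proof -
  let ?e = "d r" and ?i = "p - c div m" and ?l = "a div d r" and ?a = "a mod d r"
  have m: "0 < m" using assms(2) by (cases m) auto
  have e: "0 < ?e" using assms(1) by (cases "d r") auto
  have q: "c div m < p" using assms(2) by (rule less_mult_imp_div_less)
  have l: "?l < r" using assms(1) by (rule less_mult_imp_div_less)
  have a: "a = ?l * ?e + ?a" by simp
  have "kappa_group p d m G r $$ (a, c) = (map (kappa_row p d m G r) [0..<r] ! ?l) $$ (?a, c)"
    unfolding kappa_group_def using assms kappa_row_carrier by (intro index_vstack_uniform) auto
  also have "\<dots> = kappa_row p d m G r ?l $$ (?a, c)" using l by simp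
  also have "\<dots> = (if ?i \<le> r - ?l then G_block p d m G r (r - ?l - ?i) $$ (?a, c mod m) else 0)"
    using assms e by (intro index_kappa_row) auto
  also have "\<dots> = (if a + (?i - 1) * ?e < r * ?e then row_group p d m G r $$ (a + (?i - 1) * ?e, c mod m) else 0)"
  proof (cases "?i \<le> r - ?l")
    case True
    then have le: "?l + (?i - 1) + 1 \<le> r" using q l by linarith
    have "a + (?i - 1) * ?e = (?l + (?i - 1)) * ?e + ?a" using a by (simp add: algebra_simps)
    also have "\<dots> < (?l + (?i - 1)) * ?e + ?e" using e by simp
    also have "\<dots> = (?l + (?i - 1) + 1) * ?e" by (simp add: algebra_simps)
    also have "\<dots> \<le> r * ?e" using le by (rule mult_right_mono) simp
    finally have lt: "a + (?i - 1) * ?e < r * ?e" .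
    have "r - 1 - (r - ?l - ?i) = ?l + (?i - 1)" using True q l by linarith
    then have "(r - 1 - (r - ?l - ?i)) * ?e + ?a = a + (?i - 1) * ?e"
      using a by (simp add: algebra_simps)
    then show ?thesis using True lt m e by (simp add: G_block_def row_group_def add.assoc)
  next
    case False
    then have le: "r \<le> ?l + (?i - 1)" using q l by linarith
    have "r * ?e \<le> (?l + (?i - 1)) * ?e" using le by (rule mult_right_mono) simp
    also have "\<dots> \<le> a + (?i - 1) * ?e" using a by (simp add: algebra_simps)
    finally have "\<not> a + (?i - 1) * ?e < r * ?e" by simp
    then show ?thesis using False by simp
  qed
  also have "\<dots> = (K_mat r ?e ^\<^sub>m (?i - 1) * row_group p d m G r) $$ (a, c mod m)"
    unfolding K_mat_pow_mult[OF row_group_carrier] using assms m by simp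
  finally show ?thesis .
qed

lemma index_kappa:
  assumes "G \<in> carrier_mat (n_min p d) m" "a < n_min p d" "c < p * m"
  shows "kappa p d m G $$ (a, c) = (F_mat p d ^\<^sub>m (p - c div m - 1) * G) $$ (a, c mod m)"
proof -
  have m: "0 < m" using assms(3) by (cases m) auto
  show ?thesis
    unfolding kappa_eq_vstack F_mat_pow_mult[OF assms(1)]
  proof (rule index_vstack_cong[where a = "\<lambda>r. r * d r"])
    show "a < sum_list (map (\<lambda>r. r * d r) (rev [1..<Suc p]))" using assms(2) by (simp only: n_min_sum_list)
    show "kappa_group p d m G r $$ (i, c)
        = (K_mat r (d r) ^\<^sub>m (p - c div m - 1) * row_group p d m G r) $$ (i, c mod m)"
      if "i < r * d r" for r i using that assms(3) by (rule index_kappa_group)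
    show "kappa_group p d m G r \<in> carrier_mat (r * d r) (p * m) \<and>
        K_mat r (d r) ^\<^sub>m (p - c div m - 1) * row_group p d m G r \<in> carrier_mat (r * d r) m" for r
      by (intro conjI kappa_group_carrier mult_carrier_mat[OF pow_carrier_mat[OF K_mat_carrier] row_group_carrier])
  qed (use assms m in auto)
qed

lemma kappa_line:
  assumes "G \<in> carrier_mat (n_min p d) m" "\<eta> \<in> carrier_mat (n_min p d) m"
  shows "kappa p d m (G + s \<cdot>\<^sub>m \<eta>) = kappa p d m G + s \<cdot>\<^sub>m kappa p d m \<eta>"
proof (rule eq_matI)
  fix a c
  assume "a < dim_row (kappa p d m G + s \<cdot>\<^sub>m kappa p d m \<eta>)" "c < dim_col (kappa p d m G + s \<cdot>\<^sub>m kappa p d m \<eta>)"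
  then have ac: "a < n_min p d" "c < p * m" using kappa_carrier[of p d m \<eta>] by auto
  then have m: "c mod m < m" by (cases m) auto
  let ?F = "F_mat p d ^\<^sub>m (p - c div m - 1)"
  have F: "?F \<in> carrier_mat (n_min p d) (n_min p d)" by (rule F_mat_pow_carrier)
  have index_line: "(P + s \<cdot>\<^sub>m Q) $$ (i, j) = P $$ (i, j) + s * Q $$ (i, j)"
    if "P \<in> carrier_mat u v" "Q \<in> carrier_mat u v" "i < u" "j < v" for P Q :: "real mat" and u v i j
    using that by simp
  have "kappa p d m (G + s \<cdot>\<^sub>m \<eta>) $$ (a, c) = (?F * (G + s \<cdot>\<^sub>m \<eta>)) $$ (a, c mod m)"
    using assms ac by (intro index_kappa) auto
  also have "?F * (G + s \<cdot>\<^sub>m \<eta>) = ?F * G + s \<cdot>\<^sub>m (?F * \<eta>)"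
    unfolding mult_add_distrib_mat[OF F assms(1) smult_carrier_mat[OF assms(2)]]
      mult_smult_distrib[OF F assms(2)] ..
  also have "\<dots> $$ (a, c mod m) = (?F * G) $$ (a, c mod m) + s * (?F * \<eta>) $$ (a, c mod m)"
    by (rule index_line[OF mult_carrier_mat[OF F assms(1)] mult_carrier_mat[OF F assms(2)] ac(1) m])
  also have "\<dots> = (kappa p d m G + s \<cdot>\<^sub>m kappa p d m \<eta>) $$ (a, c)"
    unfolding index_line[OF kappa_carrier kappa_carrier ac]
      index_kappa[OF assms(1) ac] index_kappa[OF assms(2) ac] ..
  finally show "kappa p d m (G + s \<cdot>\<^sub>m \<eta>) $$ (a, c) = (kappa p d m G + s \<cdot>\<^sub>m kappa p d m \<eta>) $$ (a, c)" .
qed (simp_all add: carrier_matD[OF kappa_carrier])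

section \<open>Full row rank of kappa(G)\<close>

lemma kappa_left_annihilator:
  assumes G: "G \<in> carrier_mat (n_min p d) m" and C: "C \<in> carrier_mat q (n_min p d)"
    and 0: "C * kappa p d m G = 0\<^sub>m q (p * m)" and j: "j < p"
  shows "C * (F_mat p d ^\<^sub>m j * G) = 0\<^sub>m q m"
proof (rule eq_matI)
  fix i c assume "i < dim_row (0\<^sub>m q m :: real mat)" "c < dim_col (0\<^sub>m q m :: real mat)"
  then have ic: "i < q" "c < m" by auto
  \<comment> \<open>Power j belongs to lag j + 1, whose block column has p - 1 - j block columns to
    its left.\<close>
  define b where "b = (p - 1 - j) * m + c"
  have b: "b div m = p - 1 - j" "b mod m = c" using ic(2) by (auto simp: b_def)
  have "b < (p - 1 - j) * m + m" using ic(2) by (simp add: b_def)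
  also have "\<dots> = (p - 1 - j + 1) * m" by (simp add: algebra_simps)
  also have "\<dots> \<le> p * m" using j by (intro mult_right_mono) auto
  finally have bp: "b < p * m" .
  have FG: "F_mat p d ^\<^sub>m j * G \<in> carrier_mat (n_min p d) m"
    using F_mat_pow_carrier G by (rule mult_carrier_mat)
  have pj: "p - (p - 1 - j) - 1 = j" using j by simp
  have "(C * (F_mat p d ^\<^sub>m j * G)) $$ (i, c) = (\<Sum>a<n_min p d. C $$ (i, a) * (F_mat p d ^\<^sub>m j * G) $$ (a, c))"
    using ic C FG by (subst index_mult_mat_sum) auto
  also have "\<dots> = (\<Sum>a<n_min p d. C $$ (i, a) * kappa p d m G $$ (a, b))"
    using bp by (intro sum.cong) (simp_all only: index_kappa[OF G] b pj lessThan_iff)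
  also have "\<dots> = (C * kappa p d m G) $$ (i, b)"
    using ic bp C kappa_carrier[of p d m G] by (subst index_mult_mat_sum) auto
  finally show "(C * (F_mat p d ^\<^sub>m j * G)) $$ (i, c) = 0\<^sub>m q m $$ (i, c)"
    using 0 ic bp by simp
qed (use C G F_mat_carrier in auto)

text \<open>The matrix \<open>last_mat\<close> selects the zero rows of \<open>F\<close>.\<close>

definition last_mat :: "nat \<Rightarrow> (nat \<Rightarrow> nat) \<Rightarrow> real mat" where
  "last_mat p d = diag_block_mat (map (\<lambda>r. shift_mat (d r) (r * d r) ((r - 1) * d r)) (rev [1..<Suc p]))"

lemma last_mat_carrier: "last_mat p d \<in> carrier_mat (\<Sum>i=1..p. d i) (n_min p d)"
  using diag_block_mat_carrier[of "rev [1..<Suc p]" "\<lambda>r. shift_mat (d r) (r * d r) ((r - 1) * d r)" d "\<lambda>r. r * d r"]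
    shift_mat_carrier unfolding last_mat_def by (simp only: n_min_sum_list sum_list_rev_upt)

lemma last_mat_mult:
  assumes "G \<in> carrier_mat (n_min p d) m"
  shows "last_mat p d * G = G_zero p d m G"
proof -
  have "last_mat p d * vstack m (map (row_group p d m G) (rev [1..<Suc p]))
     = vstack m (map (\<lambda>r. shift_mat (d r) (r * d r) ((r - 1) * d r) * row_group p d m G r) (rev [1..<Suc p]))"
    unfolding last_mat_def using shift_mat_carrier row_group_carrier
    by (intro diag_block_mat_mult_vstack[where a = d and b = "\<lambda>r. r * d r"]) auto
  moreover have "shift_mat (d r) (r * d r) ((r - 1) * d r) * row_group p d m G r = G_block p d m G r 0"
    if r: "r \<in> set (rev [1..<Suc p])" for r
  proof -
    have "0 < r" using r by (auto simp del: upt_Suc)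
    then obtain r' where "r = Suc r'" by (cases r) auto
    then show ?thesis
      unfolding shift_mat_mult[OF row_group_carrier]
      by (intro eq_matI) (auto simp: G_block_def row_group_def add_ac)
  qed
  then have "map (\<lambda>r. shift_mat (d r) (r * d r) ((r - 1) * d r) * row_group p d m G r) (rev [1..<Suc p])
      = map (\<lambda>r. G_block p d m G r 0) (rev [1..<Suc p])" by (intro map_cong refl)
  ultimately show ?thesis by (simp only: vstack_row_group[OF assms] G_zero_def)
qed

text \<open>Lets a matrix D with D F = 0 be recovered from its columns selected by
  \<open>last_mat\<close>, namely as D S' S.\<close>

lemma last_mat_complement:
  "(last_mat p d)\<^sup>T * last_mat p d + F_mat p d * (F_mat p d)\<^sup>T = 1\<^sub>m (n_min p d)"
proof -
  let ?rs = "rev [1..<Suc p]" and ?S = "\<lambda>r. shift_mat (d r) (r * d r) ((r - 1) * d r)"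
  have "(last_mat p d)\<^sup>T * last_mat p d = diag_block_mat (map (\<lambda>r. (?S r)\<^sup>T * ?S r) ?rs)"
    unfolding last_mat_def diag_block_mat_transpose using shift_mat_carrier
    by (intro diag_block_mat_mult[where a = "\<lambda>r. r * d r" and b = d and c = "\<lambda>r. r * d r"]) auto
  moreover have "F_mat p d * (F_mat p d)\<^sup>T = diag_block_mat (map (\<lambda>r. K_mat r (d r) * (K_mat r (d r))\<^sup>T) ?rs)"
    unfolding F_mat_def diag_block_mat_transpose using K_mat_carrier
    by (intro diag_block_mat_mult[where a = "\<lambda>r. r * d r" and b = "\<lambda>r. r * d r" and c = "\<lambda>r. r * d r"]) auto
  moreover have "diag_block_mat (map (\<lambda>r. (?S r)\<^sup>T * ?S r) ?rs)
      + diag_block_mat (map (\<lambda>r. K_mat r (d r) * (K_mat r (d r))\<^sup>T) ?rs)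
    = diag_block_mat (map (\<lambda>r. (?S r)\<^sup>T * ?S r + K_mat r (d r) * (K_mat r (d r))\<^sup>T) ?rs)"
    by (intro diag_block_mat_add[where a = "\<lambda>r. r * d r" and b = "\<lambda>r. r * d r"] conjI
        mult_carrier_mat[OF transpose_carrier_mat[THEN iffD2, OF shift_mat_carrier] shift_mat_carrier]
        mult_carrier_mat[OF K_mat_carrier transpose_carrier_mat[THEN iffD2, OF K_mat_carrier]])
  moreover have "map (\<lambda>r. (?S r)\<^sup>T * ?S r + K_mat r (d r) * (K_mat r (d r))\<^sup>T) ?rs = map (\<lambda>r. 1\<^sub>m (r * d r)) ?rs"
    by (intro map_cong refl shift_mat_complement) auto
  ultimately show ?thesis by (simp only: diag_block_mat_one n_min_sum_list)
qed

text \<open>If \<open>C F\<^sup>j G = 0\<close> for all \<open>j\<close> and \<open>C F\<^sup>j\<^sup>+\<^sup>1 = 0\<close>, then \<open>D = C F\<^sup>j\<close> satisfies \<open>D F = 0\<close>, so \<open>D\<close> lives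
  on the last sub-blocks and \<open>0 = D G\<close> is a relation between the rows of \<open>G_zero\<close>. Hence \<open>C F\<^sup>j = 0\<close> for
  all \<open>j\<close>, starting from \<open>F\<^sup>p = 0\<close>.\<close>

lemma row_independent_kappa:
  assumes G: "G \<in> carrier_mat (n_min p d) m" and indep: "row_independent (G_zero p d m G)"
  shows "row_independent (kappa p d m G)"
proof (rule row_independentI[OF kappa_carrier])
  let ?n = "n_min p d" and ?F = "F_mat p d" and ?S = "last_mat p d"
  note F = F_mat_carrier[of p d] and S = last_mat_carrier[of p d]
  fix q and C :: "real mat" assume C: "C \<in> carrier_mat q ?n" "C * kappa p d m G = 0\<^sub>m q (p * m)"
  have "C * ?F ^\<^sub>m 0 = 0\<^sub>m q ?n"
  \<comment> \<open>Descending induction from the exponent p, where nilpotency gives the claim, to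
    the exponent 0, where the claim says C = 0.\<close>
  proof (rule inc_induct[of 0 p "\<lambda>j. C * ?F ^\<^sub>m j = 0\<^sub>m q ?n"])
    show "C * ?F ^\<^sub>m p = 0\<^sub>m q ?n" unfolding F_mat_nilpotent using C(1) by simp
    fix j assume j: "j < p" and IH: "C * ?F ^\<^sub>m Suc j = 0\<^sub>m q ?n"
    define D where "D = C * ?F ^\<^sub>m j"
    note Fj = F_mat_pow_carrier[of p d j]
    have D: "D \<in> carrier_mat q ?n" unfolding D_def using C(1) Fj by (rule mult_carrier_mat)
    have "D * ?F = C * (?F ^\<^sub>m j * ?F)" unfolding D_def by (rule assoc_mult_mat[OF C(1) Fj F])
    then have DF: "D * ?F = 0\<^sub>m q ?n" using IH by simp
    have "D * G = C * (?F ^\<^sub>m j * G)" unfolding D_def by (rule assoc_mult_mat[OF C(1) Fj G])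
    then have DG: "D * G = 0\<^sub>m q m" using kappa_left_annihilator[OF G C j] by simp
    have DS: "D * ?S\<^sup>T \<in> carrier_mat q (\<Sum>i=1..p. d i)" using D S by simp
    have "D = D * (?S\<^sup>T * ?S + ?F * ?F\<^sup>T)" unfolding last_mat_complement using D by simp
    also have "\<dots> = D * ?S\<^sup>T * ?S + D * ?F * ?F\<^sup>T"
      using D S F by (simp add: mult_add_dim mult_assoc_dim del: assoc_mult_mat)
    also have "\<dots> = D * ?S\<^sup>T * ?S" unfolding DF using D S F DS by simp
    finally have DSS: "D = D * ?S\<^sup>T * ?S" .
    have "D * ?S\<^sup>T * G_zero p d m G = D * ?S\<^sup>T * ?S * G"
      unfolding last_mat_mult[OF G, symmetric] by (rule assoc_mult_mat[symmetric, OF DS S G])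
    also have "\<dots> = 0\<^sub>m q m" using DSS DG by simp
    finally have "D * ?S\<^sup>T = 0\<^sub>m q (\<Sum>i=1..p. d i)"
      using row_independentD[OF indep _ DS] last_mat_mult[OF G] mult_carrier_mat[OF S G] by simp
    then show "C * ?F ^\<^sub>m j = 0\<^sub>m q ?n" using DSS S unfolding D_def[symmetric] by simp
  qed simp
  then show "C = 0\<^sub>m q ?n" using C(1) F by simp
qed

subsection \<open>Data matrices\<close>

lemma X_lag_carrier: "X_lag m p T Xf \<in> carrier_mat (p * m) T"
proof -
  have "vstack T (map (lag m p T Xf) (rev [1..<Suc p])) \<in> carrier_mat (sum_list (map (\<lambda>_. m) (rev [1..<Suc p]))) T"
    by (rule vstack_carrier) (simp add: lag_def)
  then show ?thesis by (simp add: X_lag_def sum_list_triv del: upt_Suc)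
qed

lemma index_X_lag:
  assumes "c < p * m" "t < T"
  shows "X_lag m p T Xf $$ (c, t) = lag m p T Xf (p - c div m) $$ (c mod m, t)"
proof -
  have q: "c div m < p" using assms(1) by (rule less_mult_imp_div_less)
  have "X_lag m p T Xf $$ (c, t) = (map (lag m p T Xf) (rev [1..<Suc p]) ! (c div m)) $$ (c mod m, t)"
    unfolding X_lag_def using assms 
    by (intro index_vstack_uniform) (auto simp: lag_def simp del: upt_Suc)
  moreover have "rev [1..<Suc p] ! (c div m) = p - c div m"
    using q by (subst rev_nth) (auto simp: Suc_diff_Suc simp del: upt_Suc)
  ultimately show ?thesis using q by (subst (asm) nth_map) (auto simp del: upt_Suc)
qed

text \<open>The columns of \<open>kappa\<close> and the rows of \<open>X_lag\<close> list the lags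
  in the same descending order. Splitting the summation index as q m + c therefore pairs the block
  column of lag p - q with the data of lag p - q.\<close>

lemma kappa_mult_X_lag:
  assumes G: "G \<in> carrier_mat (n_min p d) m" and at: "a < n_min p d" "t < T"
  shows "(kappa p d m G * X_lag m p T Xf) $$ (a, t)
    = (\<Sum>i=1..p. (F_mat p d ^\<^sub>m (i - 1) * G * lag m p T Xf i) $$ (a, t))"
proof -
  let ?f = "\<lambda>c. kappa p d m G $$ (a, c) * X_lag m p T Xf $$ (c, t)"
  have FG: "F_mat p d ^\<^sub>m j * G \<in> carrier_mat (n_min p d) m" for j
    using F_mat_pow_carrier G by (rule mult_carrier_mat)
  have "(kappa p d m G * X_lag m p T Xf) $$ (a, t) = (\<Sum>c<p * m. ?f c)"
    using at kappa_carrier[of p d m G] X_lag_carrier[of m p T Xf] by (subst index_mult_mat_sum) auto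
  also have "\<dots> = (\<Sum>q<p. \<Sum>c<m. ?f (q * m + c))"
    using sum.nat_group[of ?f m p]
    by (simp add: sum.shift_bounds_nat_ivl[of ?f 0 _ m, symmetric] sum.nat_group[symmetric]
        sum.atLeastLessThan_shift_0[of _ _ "_ + m"] lessThan_atLeast0)
  also have "\<dots> = (\<Sum>q<p. (F_mat p d ^\<^sub>m (p - q - 1) * G * lag m p T Xf (p - q)) $$ (a, t))"
  proof (rule sum.cong[OF refl])
    fix q assume "q \<in> {..<p}"
    then have "(q + 1) * m \<le> p * m" by (intro mult_right_mono) auto
    then have lt: "q * m + c < p * m" if "c < m" for c using that by (simp add: algebra_simps)
    have "(F_mat p d ^\<^sub>m (p - q - 1) * G * lag m p T Xf (p - q)) $$ (a, t)
       = (\<Sum>c<m. (F_mat p d ^\<^sub>m (p - q - 1) * G) $$ (a, c) * lag m p T Xf (p - q) $$ (c, t))"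
      using at FG[of "p - q - 1"] by (subst index_mult_mat_sum) (auto simp: lag_def)
    also have "\<dots> = (\<Sum>c<m. ?f (q * m + c))"
      using lt at by (intro sum.cong) (simp_all add: index_kappa[OF G] index_X_lag del: index_mult_mat(1))
    finally show "(\<Sum>c<m. ?f (q * m + c))
      = (F_mat p d ^\<^sub>m (p - q - 1) * G * lag m p T Xf (p - q)) $$ (a, t)" by simp
  qed
  also have "\<dots> = (\<Sum>i=1..p. (F_mat p d ^\<^sub>m (i - 1) * G * lag m p T Xf i) $$ (a, t))"
    by (rule sum.reindex_bij_witness[of _ "\<lambda>i. p - i" "\<lambda>q. p - q"]) auto
  finally show ?thesis .
qed

lemma residual_eq:
  assumes G: "G \<in> carrier_mat (n_min p d) m" and H: "H \<in> carrier_mat k (n_min p d)"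
  shows "residual k m p T d Yf Xf H G = drop_lead k p T Yf - H * (kappa p d m G * X_lag m p T Xf)"
proof -
  have KX: "kappa p d m G * X_lag m p T Xf \<in> carrier_mat (n_min p d) T"
    using kappa_carrier X_lag_carrier by (rule mult_carrier_mat)
  have lag: "lag m p T Xf i \<in> carrier_mat m T" for i by (simp add: lag_def)
  have "mat k T (\<lambda>(a, t). \<Sum>i=1..p. (Phi p d H G i * lag m p T Xf i) $$ (a, t))
      = H * (kappa p d m G * X_lag m p T Xf)"
  proof (rule eq_matI)
    fix a t assume "a < dim_row (H * (kappa p d m G * X_lag m p T Xf))"
      "t < dim_col (H * (kappa p d m G * X_lag m p T Xf))"
    then have at: "a < k" "t < T" using H KX by auto
    have term_eq: "(Phi p d H G i * lag m p T Xf i) $$ (a, t)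
       = (\<Sum>b<n_min p d. H $$ (a, b) * (F_mat p d ^\<^sub>m (i - 1) * G * lag m p T Xf i) $$ (b, t))" for i
    proof -
      note Fi = F_mat_pow_carrier[of p d "i - 1"]
      have FGL: "F_mat p d ^\<^sub>m (i - 1) * G * lag m p T Xf i \<in> carrier_mat (n_min p d) T"
        using Fi G lag[of i] by (intro mult_carrier_mat)
      have "Phi p d H G i * lag m p T Xf i = H * (F_mat p d ^\<^sub>m (i - 1) * G * lag m p T Xf i)"
        unfolding Phi_def assoc_mult_mat[OF H Fi G] by (rule assoc_mult_mat[OF H mult_carrier_mat[OF Fi G] lag])
      then show ?thesis using at H FGL by (subst \<open>_ = _\<close>, subst index_mult_mat_sum) auto
    qed
    have "(H * (kappa p d m G * X_lag m p T Xf)) $$ (a, t)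
       = (\<Sum>b<n_min p d. H $$ (a, b) * (kappa p d m G * X_lag m p T Xf) $$ (b, t))"
      using at H KX by (subst index_mult_mat_sum) auto
    also have "\<dots> = (\<Sum>b<n_min p d. \<Sum>i=1..p. H $$ (a, b) * (F_mat p d ^\<^sub>m (i - 1) * G * lag m p T Xf i) $$ (b, t))"
      using at by (intro sum.cong) (simp_all only: kappa_mult_X_lag[OF G] sum_distrib_left lessThan_iff)
    also have "\<dots> = (\<Sum>i=1..p. (Phi p d H G i * lag m p T Xf i) $$ (a, t))"
      unfolding term_eq by (rule sum.swap)
    finally show "mat k T (\<lambda>(a, t). \<Sum>i=1..p. (Phi p d H G i * lag m p T Xf i) $$ (a, t)) $$ (a, t)
        = (H * (kappa p d m G * X_lag m p T Xf)) $$ (a, t)" using at by simp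
  qed (use H KX in auto)
  then show ?thesis by (simp add: residual_def)
qed

subsection \<open>Minimizers and derivatives of the criteria\<close>

lemma is_arg_min_unique:
  fixes f :: "'a \<Rightarrow> 'b::linorder"
  assumes "P x" "\<And>y. P y \<Longrightarrow> y \<noteq> x \<Longrightarrow> f x < f y"
  shows "is_arg_min f P y \<longleftrightarrow> y = x"
proof
  assume y: "is_arg_min f P y"
  show "y = x"
  proof (rule ccontr)
    assume "y \<noteq> x"
    then have "f x < f y" using y assms(2) by (simp add: is_arg_min_def)
    then show False using y assms(1) by (auto simp: is_arg_min_def)
  qed
next
  assume "y = x"
  moreover have "\<not> f z < f x" if "P z" for z
    using assms(2)[OF that] by (cases "z = x") auto
  ultimately show "is_arg_min f P y" using assms(1) by (auto simp: is_arg_min_def)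
qed

lemma is_arg_min_cong:
  fixes f :: "'a \<Rightarrow> 'b::linorder" and g :: "'a \<Rightarrow> 'c::linorder"
  assumes "\<And>x y. P x \<Longrightarrow> P y \<Longrightarrow> f x \<le> f y \<longleftrightarrow> g x \<le> g y"
  shows "is_arg_min f P x \<longleftrightarrow> is_arg_min g P x"
  using assms by (auto simp: is_arg_min_def not_less)

lemma grad_term_eq: "grad_term p d m U G \<eta> = ld_grad U (kappa p d m G) (kappa p d m \<eta>)"
  by (simp add: grad_term_def ld_grad_def)

lemma hess_term_eq: "hess_term p d m U G \<psi> \<eta> = ld_hess U (kappa p d m G) (kappa p d m \<psi>) (kappa p d m \<eta>)"
  by (simp add: hess_term_def ld_hess_def Let_def)

text \<open>Positivity of both determinants along the line is what allows the logarithm of the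
  quotient to be split for all small s.\<close>

lemma eventually_det_congruence_pos:
  fixes K :: "real mat"
  assumes "K \<in> carrier_mat n N" "L \<in> carrier_mat n N" "U \<in> carrier_mat N N" "0 < det (K * U * K\<^sup>T)"
  shows "\<forall>\<^sub>F s in nhds 0. 0 < det ((K + s \<cdot>\<^sub>m L) * U * (K + s \<cdot>\<^sub>m L)\<^sup>T)"
proof -
  let ?F = "\<lambda>s. (K + s \<cdot>\<^sub>m L) * U * (K + s \<cdot>\<^sub>m L)\<^sup>T"
  have F0: "?F 0 = K * U * K\<^sup>T" by (simp only: add_zero_smult[OF assms(1,2)])
  have "isCont (\<lambda>s. det (?F s)) 0" by (rule det_isCont[OF congruence_deriv[OF assms(1-3)]])
  then have "((\<lambda>s. det (?F s)) \<longlongrightarrow> det (K * U * K\<^sup>T)) (at 0)" unfolding isCont_def F0 .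
  then have "\<forall>\<^sub>F s in at 0. 0 < det (?F s)" using order_tendstoD(1) assms(4) by blast
  then show ?thesis using assms(4) F0 by (simp add: eventually_nhds_conv_at)
qed

section \<open>Gradient and Hessian of the log-ratio\<close>

context
  fixes p m :: nat and d :: "nat \<Rightarrow> nat" and A B :: "real mat"
  assumes A: "A \<in> carrier_mat (p * m) (p * m)" "A\<^sup>T = A"
    and B: "B \<in> carrier_mat (p * m) (p * m)" "B\<^sup>T = B"
begin

abbreviation (input) "\<kappa> \<equiv> kappa p d m"
abbreviation (input) "det_pos G \<equiv> 0 < det (\<kappa> G * A * (\<kappa> G)\<^sup>T) \<and> 0 < det (\<kappa> G * B * (\<kappa> G)\<^sup>T)"

lemma eventually_pos:
  assumes "G \<in> carrier_mat (n_min p d) m" "\<eta> \<in> carrier_mat (n_min p d) m" "det_pos G"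
  shows "\<forall>\<^sub>F s in nhds 0. det_pos (G + s \<cdot>\<^sub>m \<eta>)"
  unfolding kappa_line[OF assms(1,2)] using assms(3) A(1) B(1)
  by (intro eventually_conj eventually_det_congruence_pos[OF kappa_carrier kappa_carrier]) auto

lemma ln_R_ratio: "det_pos G \<Longrightarrow> ln (R_ratio p d m A B G)
    = ln (det (\<kappa> G * A * (\<kappa> G)\<^sup>T)) - ln (det (\<kappa> G * B * (\<kappa> G)\<^sup>T))"
  by (simp add: R_ratio_def ln_div)

lemma ln_R_ratio_deriv:
  assumes G: "G \<in> carrier_mat (n_min p d) m" and \<eta>: "\<eta> \<in> carrier_mat (n_min p d) m" and pos: "det_pos G"
  shows "has_dir_deriv (\<lambda>G. ln (R_ratio p d m A B G)) (grad_term p d m A G \<eta> - grad_term p d m B G \<eta>) G \<eta>"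
proof -
  let ?L = "\<lambda>U s. ln (det ((\<kappa> G + s \<cdot>\<^sub>m \<kappa> \<eta>) * U * (\<kappa> G + s \<cdot>\<^sub>m \<kappa> \<eta>)\<^sup>T))"
  have "((\<lambda>s. ?L A s - ?L B s) has_real_derivative grad_term p d m A G \<eta> - grad_term p d m B G \<eta>) (at 0)"
    unfolding grad_term_eq using A B pos
    by (intro DERIV_diff ln_det_congruence_deriv[OF kappa_carrier kappa_carrier]) auto
  note d = this
  have ev: "\<forall>\<^sub>F s in nhds 0. ln (R_ratio p d m A B (G + s \<cdot>\<^sub>m \<eta>)) = ?L A s - ?L B s"
    using eventually_pos[OF G \<eta> pos]
    by eventually_elim (simp only: ln_R_ratio kappa_line[OF G \<eta>])
  show ?thesis
    unfolding has_dir_deriv_def DERIV_cong_ev[OF refl ev refl] by (rule d)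
qed

text \<open>Before it may be differentiated, the gradient formula must hold at all points near G in
  direction \<psi>, not only at G; positivity of the two determinants is an open condition and
  provides this.\<close>

lemma dir_deriv_ln_R_ratio_deriv:
  assumes G: "G \<in> carrier_mat (n_min p d) m" and \<psi>: "\<psi> \<in> carrier_mat (n_min p d) m"
    and \<eta>: "\<eta> \<in> carrier_mat (n_min p d) m" and pos: "det_pos G"
  shows "has_dir_deriv (\<lambda>G. dir_deriv (\<lambda>G. ln (R_ratio p d m A B G)) G \<eta>)
          (hess_term p d m A G \<psi> \<eta> - hess_term p d m B G \<psi> \<eta>) G \<psi>"
proof -
  let ?g = "\<lambda>U s. ld_grad U (\<kappa> G + s \<cdot>\<^sub>m \<kappa> \<psi>) (\<kappa> \<eta>)"
  have "((\<lambda>s. ?g A s - ?g B s) has_real_derivative hess_term p d m A G \<psi> \<eta> - hess_term p d m B G \<psi> \<eta>) (at 0)"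
    unfolding hess_term_eq using A B pos
    by (intro DERIV_diff ld_grad_deriv[OF kappa_carrier kappa_carrier kappa_carrier]) auto
  note d = this
  have ev: "\<forall>\<^sub>F s in nhds 0. dir_deriv (\<lambda>G. ln (R_ratio p d m A B G)) (G + s \<cdot>\<^sub>m \<psi>) \<eta> = ?g A s - ?g B s"
    using eventually_pos[OF G \<psi> pos]
  proof eventually_elim
    case (elim s)
    have "G + s \<cdot>\<^sub>m \<psi> \<in> carrier_mat (n_min p d) m" using G \<psi> by simp
    from DERIV_imp_deriv[OF ln_R_ratio_deriv[OF this \<eta> elim, unfolded has_dir_deriv_def]]
    show ?case unfolding dir_deriv_def grad_term_eq kappa_line[OF G \<psi>] .
  qed
  show ?thesis
    unfolding has_dir_deriv_def DERIV_cong_ev[OF refl ev refl] by (rule d)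
qed

end

text \<open>The positivity clauses give meaning to the inverses, the quotient and the logarithms in
  the other clauses. Equivalence of the two criteria over G is expressed both by their comparisons
  and by their minimizers, so it does not presuppose that a minimizer exists.\<close>

theorem theorem1:
  fixes k m p T :: nat and d :: "nat \<Rightarrow> nat"
    and Yf Xf Y X A B :: "real mat" and \<G> :: "real mat set"
  assumes pos: "0 < k" "0 < m" "0 < p"
    and d_p: "0 < d p"
    and d_sum: "(\<Sum>i=1..p. d i) \<le> min k m"
    and Yf: "Yf \<in> carrier_mat k (T + p)"
    and Xf: "Xf \<in> carrier_mat m (T + p)"
    and Y: "Y = drop_lead k p T Yf"
    and X: "X = X_lag m p T Xf"
    and rank: "full_row_rank (Y @\<^sub>r X)"
    and A: "A = X * X\<^sup>T - X * Y\<^sup>T * minv (Y * Y\<^sup>T) * Y * X\<^sup>T"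
    and B: "B = X * X\<^sup>T"
    and \<G>: "\<G> = {G \<in> carrier_mat (n_min p d) m. full_row_rank (G_zero p d m G)}"
  shows
    "(\<forall>G \<in> carrier_mat (n_min p d) m.
        full_row_rank (G_zero p d m G) \<longrightarrow> full_row_rank (kappa p d m G))
   \<and> 0 < det (Y * Y\<^sup>T)
   \<and> (\<forall>G \<in> \<G>. 0 < det (kappa p d m G * A * (kappa p d m G)\<^sup>T)
            \<and> 0 < det (kappa p d m G * B * (kappa p d m G)\<^sup>T))
   \<and> (\<forall>G \<in> \<G>.
        (\<forall>H. is_arg_min (\<lambda>H. residual_det k m p T d Yf Xf H G)
               (\<lambda>H. H \<in> carrier_mat k (n_min p d)) H \<longleftrightarrow> H = H_opt p d m Y X G)
      \<and> residual_det k m p T d Yf Xf (H_opt p d m Y X G) G = profile_det p d m Y X G)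
   \<and> (\<forall>G1 \<in> \<G>. \<forall>G2 \<in> \<G>.
        profile_det p d m Y X G1 \<le> profile_det p d m Y X G2
        \<longleftrightarrow> R_ratio p d m A B G1 \<le> R_ratio p d m A B G2)
   \<and> (\<forall>G. is_arg_min (profile_det p d m Y X) (\<lambda>G. G \<in> \<G>) G
        \<longleftrightarrow> is_arg_min (R_ratio p d m A B) (\<lambda>G. G \<in> \<G>) G)
   \<and> (\<forall>G \<in> \<G>. \<forall>\<eta> \<in> carrier_mat (n_min p d) m.
        has_dir_deriv (\<lambda>G. ln (R_ratio p d m A B G))
          (grad_term p d m A G \<eta> - grad_term p d m B G \<eta>) G \<eta>)
   \<and> (\<forall>G \<in> \<G>. \<forall>\<psi> \<in> carrier_mat (n_min p d) m. \<forall>\<eta> \<in> carrier_mat (n_min p d) m.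
        has_dir_deriv (\<lambda>G. dir_deriv (\<lambda>G. ln (R_ratio p d m A B G)) G \<eta>)
          (hess_term p d m A G \<psi> \<eta> - hess_term p d m B G \<psi> \<eta>) G \<psi>)"
proof -
  let ?n = "n_min p d" and ?N = "p * m"
  have Yc: "Y \<in> carrier_mat k T" unfolding Y by (simp add: drop_lead_def)
  have Xc: "X \<in> carrier_mat ?N T" unfolding X by (rule X_lag_carrier)
  have data: "row_independent (Y @\<^sub>r X)" using rank by (simp add: full_row_rank_iff)
  have "row_independent Y" by (rule row_independent_append_rows_upper[OF data Yc Xc])
  then have pdY: "posdef k (Y * Y\<^sup>T)" using Yc by (rule posdef_gram)
  then have detY: "0 < det (Y * Y\<^sup>T)" by (rule posdef_det_pos)
  have YYT: "(Y * Y\<^sup>T)\<^sup>T = Y * Y\<^sup>T" using Yc by (simp add: transpose_mult_dim)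
  note YYi = minv[OF posdef_carrier[OF pdY] posdef_det_nonzero[OF pdY]]
    minv_transpose[OF posdef_carrier[OF pdY] posdef_det_nonzero[OF pdY] YYT]
  have Bc: "B \<in> carrier_mat ?N ?N" "B\<^sup>T = B" unfolding B using Xc by (auto simp: transpose_mult_dim)
  have "X * Y\<^sup>T * minv (Y * Y\<^sup>T) * Y * X\<^sup>T \<in> carrier_mat ?N ?N" 
    using Xc Yc by (intro carrier_matI) auto
  moreover have "(X * Y\<^sup>T * minv (Y * Y\<^sup>T) * Y * X\<^sup>T)\<^sup>T = X * Y\<^sup>T * minv (Y * Y\<^sup>T) * Y * X\<^sup>T"
    using Xc Yc YYi(1,4) by (simp add: transpose_mult_dim mult_assoc_dim)
  ultimately have Ac: "A \<in> carrier_mat ?N ?N" "A\<^sup>T = A"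
    using Bc Xc unfolding A B by (auto simp: transpose_minus[of _ ?N ?N])
  have regression: "regression k ?N ?n T Y X (kappa p d m G)" if "G \<in> \<G>" for G
  proof
    show "row_independent (kappa p d m G)"
      using that by (intro row_independent_kappa) (auto simp: \<G> full_row_rank_iff)
  qed (use Yc Xc data kappa_carrier in auto)
  have dets: "0 < det (kappa p d m G * A * (kappa p d m G)\<^sup>T)" "0 < det (kappa p d m G * B * (kappa p d m G)\<^sup>T)"
    "(\<forall>H. is_arg_min (\<lambda>H. residual_det k m p T d Yf Xf H G)
               (\<lambda>H. H \<in> carrier_mat k (n_min p d)) H \<longleftrightarrow> H = H_opt p d m Y X G)"
    "residual_det k m p T d Yf Xf (H_opt p d m Y X G) G = profile_det p d m Y X G"
    "profile_det p d m Y X G = det (Y * Y\<^sup>T) * R_ratio p d m A B G" if G: "G \<in> \<G>" for G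
  proof -
    let ?K = "kappa p d m G"
    interpret reg: regression k ?N ?n T Y X ?K by (rule regression[OF G])
    have Gc: "G \<in> carrier_mat ?n m" using G by (simp add: \<G>)
    note Kc = kappa_carrier[of p d m G]
    show A_pos: "0 < det (?K * A * ?K\<^sup>T)" unfolding A by (rule reg.det_KAK_pos)
    have S: "reg.S = ?K * B * ?K\<^sup>T"
      unfolding reg.Z_def B using Kc Xc by (simp add: transpose_mult_dim mult_assoc_dim)
    have S': "?K * X * X\<^sup>T * ?K\<^sup>T = reg.S"
      unfolding reg.Z_def using Kc Xc by (simp add: transpose_mult_dim mult_assoc_dim)
    show B_pos: "0 < det (?K * B * ?K\<^sup>T)" using reg.det_S_pos unfolding S .
    have YZ: "Y * X\<^sup>T * ?K\<^sup>T = Y * reg.Z\<^sup>T"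
      unfolding reg.Z_def using Kc Xc Yc by (simp add: transpose_mult_dim mult_assoc_dim)
    have H_opt: "H_opt p d m Y X G = reg.H\<^sub>0" unfolding H_opt_def reg.H\<^sub>0_def S' YZ ..
    have res: "residual_det k m p T d Yf Xf H G = det (reg.E H * (reg.E H)\<^sup>T)"
      if "H \<in> carrier_mat k ?n" for H
      unfolding residual_det_def residual_eq[OF Gc that] reg.E_def reg.Z_def X[symmetric] Y[symmetric] ..
    have "Y * reg.Z\<^sup>T * minv reg.S * ?K * X * Y\<^sup>T = Y * reg.Z\<^sup>T * (minv reg.S * (reg.Z * Y\<^sup>T))"
    proof -
      have V: "Y * reg.Z\<^sup>T * minv reg.S \<in> carrier_mat k ?n"
        using Yc reg.Z reg.S_inv(1) by (intro carrier_matI) auto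
      have "Y * reg.Z\<^sup>T * minv reg.S * ?K * X = Y * reg.Z\<^sup>T * minv reg.S * reg.Z"
        using assoc_mult_mat[OF V Kc Xc] by (simp only: reg.Z_def)
      then show ?thesis using Yc reg.Z reg.S_inv(1) by (simp add: mult_assoc_dim)
    qed
    then have prof: "profile_det p d m Y X G = det (reg.E reg.H\<^sub>0 * (reg.E reg.H\<^sub>0)\<^sup>T)"
      unfolding profile_det_def S' YZ reg.E_H\<^sub>0_gram by simp
    show "residual_det k m p T d Yf Xf (H_opt p d m Y X G) G = profile_det p d m Y X G"
      unfolding H_opt res[OF reg.H\<^sub>0] prof ..
    show "(\<forall>H. is_arg_min (\<lambda>H. residual_det k m p T d Yf Xf H G)
               (\<lambda>H. H \<in> carrier_mat k (n_min p d)) H \<longleftrightarrow> H = H_opt p d m Y X G)"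
      unfolding H_opt using reg.residual_det_gt reg.H\<^sub>0 by (intro allI is_arg_min_unique) (auto simp: res)
    \<comment> \<open>The determinant identity of the locale, divided by the positive determinant
      belonging to B.\<close>
    show "profile_det p d m Y X G = det (Y * Y\<^sup>T) * R_ratio p d m A B G"
      using reg.det_profile B_pos unfolding prof R_ratio_def S[symmetric] A by (simp add: field_simps)
  qed
  \<comment> \<open>The factor det (Y Y') is positive and the same for all G, so it preserves
    comparisons.\<close>
  have le_iff: "profile_det p d m Y X G1 \<le> profile_det p d m Y X G2 \<longleftrightarrow> R_ratio p d m A B G1 \<le> R_ratio p d m A B G2"
    if "G1 \<in> \<G>" "G2 \<in> \<G>" for G1 G2
    unfolding dets(5)[OF that(1)] dets(5)[OF that(2)] using detY by simp
  have Gc: "G \<in> carrier_mat ?n m" if "G \<in> \<G>" for G using that by (simp add: \<G>)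
  show ?thesis
  proof (intro conjI ballI allI impI)
    show "full_row_rank (kappa p d m G)"
      if "G \<in> carrier_mat ?n m" "full_row_rank (G_zero p d m G)" for G
      using that by (simp add: full_row_rank_iff row_independent_kappa)
    show "is_arg_min (profile_det p d m Y X) (\<lambda>G. G \<in> \<G>) G
        \<longleftrightarrow> is_arg_min (R_ratio p d m A B) (\<lambda>G. G \<in> \<G>) G" for G
      by (rule is_arg_min_cong[OF le_iff])
    show "has_dir_deriv (\<lambda>G. ln (R_ratio p d m A B G))
          (grad_term p d m A G \<eta> - grad_term p d m B G \<eta>) G \<eta>"
      if "G \<in> \<G>" "\<eta> \<in> carrier_mat ?n m" for G \<eta>
      using ln_R_ratio_deriv[OF Ac Bc Gc[OF that(1)] that(2)] dets(1,2)[OF that(1)] by blast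
    show "has_dir_deriv (\<lambda>G. dir_deriv (\<lambda>G. ln (R_ratio p d m A B G)) G \<eta>)
          (hess_term p d m A G \<psi> \<eta> - hess_term p d m B G \<psi> \<eta>) G \<psi>"
      if "G \<in> \<G>" "\<psi> \<in> carrier_mat ?n m" "\<eta> \<in> carrier_mat ?n m" for G \<psi> \<eta>
      using dir_deriv_ln_R_ratio_deriv[OF Ac Bc Gc[OF that(1)] that(2,3)] dets(1,2)[OF that(1)] by blast
    show "is_arg_min (\<lambda>H. residual_det k m p T d Yf Xf H G) (\<lambda>H. H \<in> carrier_mat k ?n) H
        \<longleftrightarrow> H = H_opt p d m Y X G" if "G \<in> \<G>" for G H
      using dets(3)[OF that] by blast
  qed (fact detY dets(1,2,4) le_iff)+
qed

end
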